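(* Let $\mathcal{C}$ be a locally finite abelian category and $\mathcal{F}:\mathcal{C}\to\mathcal{D}$ a strong exact functor which preserves socle (or radical) filtrations. Then $\mathcal{F}:\mathcal{C}\to\mathcal{D}$ preserves the associated Loewy diagrams.
   Context: Locally finite: abelian and $\Bbbk$-linear over a field $\Bbbk$, such that spaces of morphisms are finite dimensional and every object has finite length. The target $\mathcal{D}$ is an abelian category. Strong exact: an exact functor $\mathcal{F}:\mathcal{C}\to\mathcal{D}$ is strong exact if any short exact sequence $0\to U\to V\to W\to 0$ in $\mathcal{C}$ splits if and only if the short exact sequence $0\to\mathcal{F}(U)\to\mathcal{F}(V)\to\mathcal{F}(W)\to 0$ in $\mathcal{D}$ induced by $\mathcal{F}$ splits. Loewy series: a series of an object $M$ is a strictly increasing finite family of subobjects ordered by inclusion, from $0$ to $M$; its length is the number of successive quotients. A Loewy series of $M$ is a series of minimal length amongst those series which have semisimple successive quotients; the Loewy length of $M$ is this minimal length. Socle and radical filtrations: the socle $\mathrm{Soc}(M)$ is the largest semisimple subobject of $M$; the radical $\mathrm{Rad}(M)$ is the intersection of all maximal subobjects of $M$. Two standard examples of Loewy series are the following. The radical series (filtration) $0=\mathrm{rad}_n(M)\subset\mathrm{rad}_{n-1}(M)\subset\cdots\subset\mathrm{rad}_1(M)\subset\mathrm{rad}_0(M)=M$ is defined inductively by $\mathrm{rad}_0(M)=M$ and $\mathrm{rad}_k(M)=\mathrm{Rad}(\mathrm{rad}_{k-1}(M))$. The socle series (filtration) $0=\mathrm{soc}_0(M)\subset\mathrm{soc}_1(M)\subset\cdots\subset\mathrm{soc}_n(M)=M$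 is defined inductively by $\mathrm{soc}_1(M)=\mathrm{Soc}(M)$ and letting $\mathrm{soc}_k(M)$ be the unique subobject of $M$ such that $\mathrm{Soc}(M/\mathrm{soc}_{k-1}(M))\cong\mathrm{soc}_k(M)/\mathrm{soc}_{k-1}(M)$. Preserving filtrations: $\mathcal{F}$ preserves socle filtrations if for every $X\in\mathcal{C}$ the Loewy lengths of $X$ and $\mathcal{F}(X)$ coincide and $\mathcal{F}(\mathrm{soc}_k(X))\cong\mathrm{soc}_k(\mathcal{F}(X))$ for $k=1,\dots,n$, with $n$ the Loewy length of $X$. It preserves radical filtrations if for every $X\in\mathcal{C}$ the Loewy lengths of $X$ and $\mathcal{F}(X)$ coincide and $\mathcal{F}(\mathrm{rad}_k(X))\cong\mathrm{rad}_k(\mathcal{F}(X))$ for $k=1,\dots,n$, with $n$ the Loewy length of $X$. Loewy diagram: given a fixed Loewy series $0=M_0\subset M_1\subset\cdots\subset M_n=M$ of $M$, the associated Loewy diagram consists of horizontal layers, where the $k$-th layer from the bottom consists of the simple factors in $M_k/M_{k-1}$, annotated with arrows from an irreducible factor $X_k$ in layer $k$ to an irreducible factor $X_{k-1}$ in layer $k-1$ if there exists a subquotient $Z$ of $M_k/M_{k-2}$ such that there exists a non-split short exact sequence $0\to X_{k-1}\to Z\to X_k\to 0$. Preserving Loewy diagrams: let $0=M_0\subset M_1\subset\cdots\subset M_n=X$ be the socle or radical filtration of $X\in\mathcal{C}$, and let $X_k$ denote a simple factor of $M_k/M_{k-1}$. A functor $\mathcal{F}:\mathcal{C}\to\mathcal{D}$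 which preserves the socle or radical filtration preserves the associated Loewy diagram if whenever there exists an arrow from $X_k$ in layer $k$ to $X_{k-1}$ in layer $k-1$ in the Loewy diagram of $X$, there exists an arrow from $\mathcal{F}(X_k)$ in layer $k$ to $\mathcal{F}(X_{k-1})$ in layer $k-1$ of the Loewy diagram of $\mathcal{F}(X)$ (the diagram associated to the socle, respectively radical, filtration of $\mathcal{F}(X)$). $\mathcal{F}$ preserves the associated Loewy diagrams if this holds for every $X\in\mathcal{C}$.
   Formalization: Arrows from F(X_k) to F(X_{k-1}) in the diagram of F(X) are understood between factors of the layers that need not be simple, since F(M)=M⊕M satisfies the hypotheses but does not preserve simplicity; semisimple means a finite direct sum of simple objects. *)

theory Defs
  imports "HOL-Algebra.Module"
begin

section \<open>Preadditive and abelian categories\<close>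

text \<open>Each set of parallel morphisms carries an addition with neutral element \<open>Zero a b\<close>.
  All operations are meaningful only on the objects and morphisms of the category.\<close>

record ('o, 'm) precat =
  Ob :: "'o set"
  Arr :: "'m set"
  Dom :: "'m \<Rightarrow> 'o"
  Cod :: "'m \<Rightarrow> 'o"
  Id :: "'o \<Rightarrow> 'm"
  Comp :: "'m \<Rightarrow> 'm \<Rightarrow> 'm"  (infixl "\<cdot>\<index>" 70)
  Add :: "'m \<Rightarrow> 'm \<Rightarrow> 'm"
  Zero :: "'o \<Rightarrow> 'o \<Rightarrow> 'm"

definition Hom :: "('o, 'm, 'z) precat_scheme \<Rightarrow> 'o \<Rightarrow> 'o \<Rightarrow> 'm set" where
  "Hom C a b = {f \<in> Arr C. Dom C f = a \<and> Cod C f = b}"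

text \<open>The abelian group of morphisms from \<open>a\<close> to \<open>b\<close>, as a ring record whose
  multiplicative part is unused.\<close>

definition hom_group :: "('o, 'm, 'z) precat_scheme \<Rightarrow> 'o \<Rightarrow> 'o \<Rightarrow> 'm ring" where
  "hom_group C a b =
     \<lparr>carrier = Hom C a b, mult = undefined, one = undefined,
      zero = Zero C a b, add = Add C\<rparr>"

locale category =
  fixes C :: "('o, 'm, 'z) precat_scheme" (structure)
  assumes dom_in_Ob: "f \<in> Arr C \<Longrightarrow> Dom C f \<in> Ob C"
    and cod_in_Ob: "f \<in> Arr C \<Longrightarrow> Cod C f \<in> Ob C"
    and id_in_Hom: "a \<in> Ob C \<Longrightarrow> Id C a \<in> Hom C a a"
    and comp_in_Hom: "\<lbrakk>f \<in> Hom C a b; g \<in> Hom C b c\<rbrakk> \<Longrightarrow> g \<cdot> f \<in> Hom C a c"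
    and comp_assoc: "\<lbrakk>f \<in> Hom C a b; g \<in> Hom C b c; h \<in> Hom C c d\<rbrakk>
                       \<Longrightarrow> h \<cdot> (g \<cdot> f) = (h \<cdot> g) \<cdot> f"
    and comp_id_right: "f \<in> Hom C a b \<Longrightarrow> f \<cdot> Id C a = f"
    and comp_id_left: "f \<in> Hom C a b \<Longrightarrow> Id C b \<cdot> f = f"

locale preadditive_category = category +
  assumes hom_abelian_group: "\<lbrakk>a \<in> Ob C; b \<in> Ob C\<rbrakk> \<Longrightarrow> abelian_group (hom_group C a b)"
    and comp_add_right: "\<lbrakk>f \<in> Hom C a b; f' \<in> Hom C a b; g \<in> Hom C b c\<rbrakk>
                           \<Longrightarrow> g \<cdot> (Add C f f') = Add C (g \<cdot> f) (g \<cdot> f')"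
    and comp_add_left: "\<lbrakk>f \<in> Hom C a b; g \<in> Hom C b c; g' \<in> Hom C b c\<rbrakk>
                           \<Longrightarrow> (Add C g g') \<cdot> f = Add C (g \<cdot> f) (g' \<cdot> f)"

definition monic :: "('o, 'm, 'z) precat_scheme \<Rightarrow> 'm \<Rightarrow> bool" where
  "monic C f \<longleftrightarrow> f \<in> Arr C \<and>
     (\<forall>a. \<forall>g \<in> Hom C a (Dom C f). \<forall>h \<in> Hom C a (Dom C f).
        f \<cdot>\<^bsub>C\<^esub> g = f \<cdot>\<^bsub>C\<^esub> h \<longrightarrow> g = h)"

definition epic :: "('o, 'm, 'z) precat_scheme \<Rightarrow> 'm \<Rightarrow> bool" where
  "epic C f \<longleftrightarrow> f \<in> Arr C \<and>
     (\<forall>b. \<forall>g \<in> Hom C (Cod C f) b. \<forall>h \<in> Hom C (Cod C f) b.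
        g \<cdot>\<^bsub>C\<^esub> f = h \<cdot>\<^bsub>C\<^esub> f \<longrightarrow> g = h)"

definition iso_arr :: "('o, 'm, 'z) precat_scheme \<Rightarrow> 'm \<Rightarrow> bool" where
  "iso_arr C f \<longleftrightarrow> f \<in> Arr C \<and>
     (\<exists>g \<in> Hom C (Cod C f) (Dom C f).
        g \<cdot>\<^bsub>C\<^esub> f = Id C (Dom C f) \<and> f \<cdot>\<^bsub>C\<^esub> g = Id C (Cod C f))"

definition isomorphic :: "('o, 'm, 'z) precat_scheme \<Rightarrow> 'o \<Rightarrow> 'o \<Rightarrow> bool" where
  "isomorphic C a b \<longleftrightarrow> (\<exists>f \<in> Hom C a b. iso_arr C f)"

definition zero_object :: "('o, 'm, 'z) precat_scheme \<Rightarrow> 'o \<Rightarrow> bool" where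
  "zero_object C z \<longleftrightarrow> z \<in> Ob C \<and>
     (\<forall>a \<in> Ob C. (\<exists>!f. f \<in> Hom C z a) \<and> (\<exists>!f. f \<in> Hom C a z))"

definition is_kernel :: "('o, 'm, 'z) precat_scheme \<Rightarrow> 'm \<Rightarrow> 'm \<Rightarrow> bool" where
  "is_kernel C f k \<longleftrightarrow> f \<in> Arr C \<and> k \<in> Arr C \<and> Cod C k = Dom C f \<and>
     f \<cdot>\<^bsub>C\<^esub> k = Zero C (Dom C k) (Cod C f) \<and>
     (\<forall>a. \<forall>g \<in> Hom C a (Dom C f). f \<cdot>\<^bsub>C\<^esub> g = Zero C a (Cod C f) \<longrightarrow>
        (\<exists>!u. u \<in> Hom C a (Dom C k) \<and> k \<cdot>\<^bsub>C\<^esub> u = g))"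

definition is_cokernel :: "('o, 'm, 'z) precat_scheme \<Rightarrow> 'm \<Rightarrow> 'm \<Rightarrow> bool" where
  "is_cokernel C f q \<longleftrightarrow> f \<in> Arr C \<and> q \<in> Arr C \<and> Dom C q = Cod C f \<and>
     q \<cdot>\<^bsub>C\<^esub> f = Zero C (Dom C f) (Cod C q) \<and>
     (\<forall>b. \<forall>g \<in> Hom C (Cod C f) b. g \<cdot>\<^bsub>C\<^esub> f = Zero C (Dom C f) b \<longrightarrow>
        (\<exists>!u. u \<in> Hom C (Cod C q) b \<and> u \<cdot>\<^bsub>C\<^esub> q = g))"

text \<open>\<open>M\<close> is the direct sum (biproduct) of \<open>A 0, \<dots>, A (n - 1)\<close>; for \<open>n = 0\<close> this says that
  \<open>M\<close> is a zero object.\<close>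

definition direct_sum ::
  "('o, 'm, 'z) precat_scheme \<Rightarrow> nat \<Rightarrow> (nat \<Rightarrow> 'o) \<Rightarrow> 'o \<Rightarrow> bool" where
  "direct_sum C n A M \<longleftrightarrow> M \<in> Ob C \<and>
     (\<exists>\<iota> \<pi>. (\<forall>i<n. \<iota> i \<in> Hom C (A i) M \<and> \<pi> i \<in> Hom C M (A i)) \<and>
        (\<forall>i<n. \<forall>j<n. \<pi> i \<cdot>\<^bsub>C\<^esub> \<iota> j = (if i = j then Id C (A i) else Zero C (A j) (A i))) \<and>
        finsum (hom_group C M M) (\<lambda>i. \<iota> i \<cdot>\<^bsub>C\<^esub> \<pi> i) {..<n} = Id C M)"

locale abelian_category = preadditive_category +
  assumes direct_sums: "(\<forall>i<n. A i \<in> Ob C) \<Longrightarrow> \<exists>M. direct_sum C n A M"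
    and kernels: "f \<in> Arr C \<Longrightarrow> \<exists>k. is_kernel C f k"
    and cokernels: "f \<in> Arr C \<Longrightarrow> \<exists>q. is_cokernel C f q"
    and monic_normal: "monic C f \<Longrightarrow> \<exists>g. is_kernel C g f"
    and epic_normal: "epic C f \<Longrightarrow> \<exists>g. is_cokernel C g f"


section \<open>Subobjects, quotients and semisimplicity\<close>

text \<open>A subobject of \<open>M\<close> is represented by a monomorphism into \<open>M\<close>; inclusion is the preorder
  \<open>sub_le\<close>, and two monomorphisms represent the same subobject iff each is below the other.\<close>

definition subobject :: "('o, 'm, 'z) precat_scheme \<Rightarrow> 'o \<Rightarrow> 'm \<Rightarrow> bool" where
  "subobject C M s \<longleftrightarrow> monic C s \<and> Cod C s = M"

definition sub_le :: "('o, 'm, 'z) precat_scheme \<Rightarrow> 'm \<Rightarrow> 'm \<Rightarrow> bool" where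
  "sub_le C s t \<longleftrightarrow> (\<exists>u \<in> Hom C (Dom C s) (Dom C t). t \<cdot>\<^bsub>C\<^esub> u = s)"

definition sub_less :: "('o, 'm, 'z) precat_scheme \<Rightarrow> 'm \<Rightarrow> 'm \<Rightarrow> bool" where
  "sub_less C s t \<longleftrightarrow> sub_le C s t \<and> \<not> sub_le C t s"

text \<open>For subobjects \<open>s \<le> t\<close> of the same object, \<open>Q\<close> is (a representative of) \<open>t / s\<close>.\<close>

definition quotient :: "('o, 'm, 'z) precat_scheme \<Rightarrow> 'm \<Rightarrow> 'm \<Rightarrow> 'o \<Rightarrow> bool" where
  "quotient C t s Q \<longleftrightarrow>
     (\<exists>u q. u \<in> Hom C (Dom C s) (Dom C t) \<and> t \<cdot>\<^bsub>C\<^esub> u = s \<and> is_cokernel C u q \<and> Cod C q = Q)"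

definition subquotient :: "('o, 'm, 'z) precat_scheme \<Rightarrow> 'o \<Rightarrow> 'o \<Rightarrow> bool" where
  "subquotient C M Z \<longleftrightarrow>
     (\<exists>i p. subobject C M i \<and> epic C p \<and> Dom C p = Dom C i \<and> Cod C p = Z)"

definition simple :: "('o, 'm, 'z) precat_scheme \<Rightarrow> 'o \<Rightarrow> bool" where
  "simple C S \<longleftrightarrow> S \<in> Ob C \<and> \<not> zero_object C S \<and>
     (\<forall>s. subobject C S s \<longrightarrow> zero_object C (Dom C s) \<or> iso_arr C s)"

text \<open>Direct sums in an abelian category are finite; the zero object is semisimple.\<close>

definition semisimple :: "('o, 'm, 'z) precat_scheme \<Rightarrow> 'o \<Rightarrow> bool" where
  "semisimple C M \<longleftrightarrow> (\<exists>n A. (\<forall>i<n. simple C (A i)) \<and> direct_sum C n A M)"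


section \<open>Series and Loewy length\<close>

text \<open>A series of length \<open>n\<close> is given by monomorphisms \<open>m 0, \<dots>, m n\<close> into \<open>M\<close>.\<close>

definition series :: "('o, 'm, 'z) precat_scheme \<Rightarrow> 'o \<Rightarrow> nat \<Rightarrow> (nat \<Rightarrow> 'm) \<Rightarrow> bool" where
  "series C M n m \<longleftrightarrow>
     (\<forall>i\<le>n. subobject C M (m i)) \<and> zero_object C (Dom C (m 0)) \<and> iso_arr C (m n) \<and>
     (\<forall>i<n. sub_less C (m i) (m (Suc i)))"

definition finite_length :: "('o, 'm, 'z) precat_scheme \<Rightarrow> 'o \<Rightarrow> bool" where
  "finite_length C M \<longleftrightarrow>
     (\<exists>n m. series C M n m \<and> (\<forall>i<n. \<exists>Q. quotient C (m (Suc i)) (m i) Q \<and> simple C Q))"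

definition semisimple_series ::
  "('o, 'm, 'z) precat_scheme \<Rightarrow> 'o \<Rightarrow> nat \<Rightarrow> (nat \<Rightarrow> 'm) \<Rightarrow> bool" where
  "semisimple_series C M n m \<longleftrightarrow>
     series C M n m \<and> (\<forall>i<n. \<exists>Q. quotient C (m (Suc i)) (m i) Q \<and> semisimple C Q)"

text \<open>A relation, since in a general abelian category an object need not have a Loewy length.\<close>

definition loewy_length :: "('o, 'm, 'z) precat_scheme \<Rightarrow> 'o \<Rightarrow> nat \<Rightarrow> bool" where
  "loewy_length C M n \<longleftrightarrow>
     (\<exists>m. semisimple_series C M n m) \<and> (\<forall>n' m'. semisimple_series C M n' m' \<longrightarrow> n \<le> n')"


section \<open>Locally finite abelian categories\<close>

definition hom_module ::
  "('o, 'm, 'z) precat_scheme \<Rightarrow> ('k \<Rightarrow> 'm \<Rightarrow> 'm) \<Rightarrow> 'o \<Rightarrow> 'o \<Rightarrow> ('k, 'm) module" where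
  "hom_module C sc a b =
     \<lparr>carrier = Hom C a b, mult = undefined, one = undefined,
      zero = Zero C a b, add = Add C, smult = sc\<rparr>"

definition finite_dimensional ::
  "('k, 'r) ring_scheme \<Rightarrow> ('k, 'v, 's) module_scheme \<Rightarrow> bool" where
  "finite_dimensional K V \<longleftrightarrow>
     (\<exists>B. finite B \<and> B \<subseteq> carrier V \<and>
        (\<forall>v \<in> carrier V. \<exists>c \<in> B \<rightarrow> carrier K. v = (\<Oplus>\<^bsub>V\<^esub>b\<in>B. c b \<odot>\<^bsub>V\<^esub> b)))"

locale locally_finite_category = abelian_category C + field K
  for C :: "('o, 'm, 'z) precat_scheme" (structure)
    and K :: "('k, 'r) ring_scheme"
    and sc :: "'k \<Rightarrow> 'm \<Rightarrow> 'm" +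
  assumes hom_is_module: "\<lbrakk>a \<in> Ob C; b \<in> Ob C\<rbrakk> \<Longrightarrow> module K (hom_module C sc a b)"
    and comp_scale_right: "\<lbrakk>c \<in> carrier K; f \<in> Hom C a b; g \<in> Hom C b d\<rbrakk>
                             \<Longrightarrow> g \<cdot> (sc c f) = sc c (g \<cdot> f)"
    and comp_scale_left: "\<lbrakk>c \<in> carrier K; f \<in> Hom C a b; g \<in> Hom C b d\<rbrakk>
                             \<Longrightarrow> (sc c g) \<cdot> f = sc c (g \<cdot> f)"
    and hom_finite_dimensional:
      "\<lbrakk>a \<in> Ob C; b \<in> Ob C\<rbrakk> \<Longrightarrow> finite_dimensional K (hom_module C sc a b)"
    and objects_finite_length: "M \<in> Ob C \<Longrightarrow> finite_length C M"


section \<open>Socle and radical filtrations\<close>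

definition is_socle :: "('o, 'm, 'z) precat_scheme \<Rightarrow> 'o \<Rightarrow> 'm \<Rightarrow> bool" where
  "is_socle C M s \<longleftrightarrow> subobject C M s \<and> semisimple C (Dom C s) \<and>
     (\<forall>t. subobject C M t \<and> semisimple C (Dom C t) \<longrightarrow> sub_le C t s)"

definition maximal_subobject :: "('o, 'm, 'z) precat_scheme \<Rightarrow> 'o \<Rightarrow> 'm \<Rightarrow> bool" where
  "maximal_subobject C M s \<longleftrightarrow> subobject C M s \<and> \<not> iso_arr C s \<and>
     (\<forall>t. subobject C M t \<and> sub_le C s t \<longrightarrow> sub_le C t s \<or> iso_arr C t)"

text \<open>The intersection of a family of subobjects is its infimum.\<close>

definition is_radical :: "('o, 'm, 'z) precat_scheme \<Rightarrow> 'o \<Rightarrow> 'm \<Rightarrow> bool" where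
  "is_radical C M r \<longleftrightarrow> subobject C M r \<and>
     (\<forall>s. maximal_subobject C M s \<longrightarrow> sub_le C r s) \<and>
     (\<forall>t. subobject C M t \<and> (\<forall>s. maximal_subobject C M s \<longrightarrow> sub_le C t s) \<longrightarrow> sub_le C t r)"

text \<open>For subobjects \<open>s \<le> t\<close> of \<open>M\<close>, the canonical monomorphism \<open>t / s \<rightarrow> M / s\<close> is the socle
  of \<open>M / s\<close>. Here \<open>c\<close> is the projection of \<open>t\<close> onto \<open>t / s\<close>, \<open>q\<close> that of \<open>M\<close> onto \<open>M / s\<close>,
  and \<open>j\<close> the induced morphism.\<close>

definition socle_step :: "('o, 'm, 'z) precat_scheme \<Rightarrow> 'm \<Rightarrow> 'm \<Rightarrow> bool" where
  "socle_step C s t \<longleftrightarrow>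
     (\<exists>u c q j. u \<in> Hom C (Dom C s) (Dom C t) \<and> t \<cdot>\<^bsub>C\<^esub> u = s \<and>
        is_cokernel C u c \<and> is_cokernel C s q \<and>
        j \<in> Hom C (Cod C c) (Cod C q) \<and> j \<cdot>\<^bsub>C\<^esub> c = q \<cdot>\<^bsub>C\<^esub> t \<and>
        is_socle C (Cod C q) j)"

text \<open>\<open>m k\<close> represents \<open>soc\<^sub>k(M)\<close>, and \<open>n\<close> is the Loewy length.\<close>

definition socle_filtration ::
  "('o, 'm, 'z) precat_scheme \<Rightarrow> 'o \<Rightarrow> nat \<Rightarrow> (nat \<Rightarrow> 'm) \<Rightarrow> bool" where
  "socle_filtration C M n m \<longleftrightarrow> loewy_length C M n \<and>
     (\<forall>i\<le>n. subobject C M (m i)) \<and> zero_object C (Dom C (m 0)) \<and> iso_arr C (m n) \<and>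
     (\<forall>i<n. socle_step C (m i) (m (Suc i)))"

text \<open>\<open>m k\<close> represents \<open>rad\<^sub>k(M)\<close>, so the numbering runs from the top of \<open>M\<close> downwards.\<close>

definition radical_filtration ::
  "('o, 'm, 'z) precat_scheme \<Rightarrow> 'o \<Rightarrow> nat \<Rightarrow> (nat \<Rightarrow> 'm) \<Rightarrow> bool" where
  "radical_filtration C M n m \<longleftrightarrow> loewy_length C M n \<and>
     (\<forall>i\<le>n. subobject C M (m i)) \<and> iso_arr C (m 0) \<and> zero_object C (Dom C (m n)) \<and>
     (\<forall>i<n. \<exists>r. is_radical C (Dom C (m i)) r \<and> m (Suc i) = m i \<cdot>\<^bsub>C\<^esub> r)"


section \<open>Loewy diagrams\<close>

definition short_exact :: "('o, 'm, 'z) precat_scheme \<Rightarrow> 'm \<Rightarrow> 'm \<Rightarrow> bool" where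
  "short_exact C f g \<longleftrightarrow> is_kernel C g f \<and> is_cokernel C f g"

definition splits :: "('o, 'm, 'z) precat_scheme \<Rightarrow> 'm \<Rightarrow> 'm \<Rightarrow> bool" where
  "splits C f g \<longleftrightarrow> short_exact C f g \<and>
     (\<exists>s \<in> Hom C (Cod C g) (Dom C g). g \<cdot>\<^bsub>C\<^esub> s = Id C (Cod C g))"

text \<open>For a filtration \<open>m 0 \<le> \<dots> \<le> m n\<close>: \<open>A\<close> is a factor of layer \<open>k\<close>, \<open>B\<close> is a factor of layer
  \<open>k - 1\<close>, and a subquotient of \<open>m k / m (k - 2)\<close> is a non-split extension of \<open>A\<close> by \<open>B\<close>.
  The factors are not yet required to be simple.\<close>

definition layer_arrow ::
  "('o, 'm, 'z) precat_scheme \<Rightarrow> nat \<Rightarrow> (nat \<Rightarrow> 'm) \<Rightarrow> nat \<Rightarrow> 'o \<Rightarrow> 'o \<Rightarrow> bool" where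
  "layer_arrow C n m k A B \<longleftrightarrow> 2 \<le> k \<and> k \<le> n \<and>
     (\<exists>Q. quotient C (m k) (m (k - 1)) Q \<and> subquotient C Q A) \<and>
     (\<exists>Q. quotient C (m (k - 1)) (m (k - 2)) Q \<and> subquotient C Q B) \<and>
     (\<exists>Q Z f g. quotient C (m k) (m (k - 2)) Q \<and> subquotient C Q Z \<and>
        f \<in> Hom C B Z \<and> g \<in> Hom C Z A \<and> short_exact C f g \<and> \<not> splits C f g)"

definition socle_layer_arrow ::
  "('o, 'm, 'z) precat_scheme \<Rightarrow> 'o \<Rightarrow> nat \<Rightarrow> 'o \<Rightarrow> 'o \<Rightarrow> bool" where
  "socle_layer_arrow C M k A B \<longleftrightarrow>
     (\<exists>n m. socle_filtration C M n m \<and> layer_arrow C n m k A B)"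

definition radical_layer_arrow ::
  "('o, 'm, 'z) precat_scheme \<Rightarrow> 'o \<Rightarrow> nat \<Rightarrow> 'o \<Rightarrow> 'o \<Rightarrow> bool" where
  "radical_layer_arrow C M k A B \<longleftrightarrow>
     (\<exists>n m. radical_filtration C M n m \<and> layer_arrow C n (\<lambda>i. m (n - i)) k A B)"

text \<open>The arrows of the Loewy diagrams of \<open>M\<close> associated to its socle and radical filtration.\<close>

definition socle_diagram_arrow ::
  "('o, 'm, 'z) precat_scheme \<Rightarrow> 'o \<Rightarrow> nat \<Rightarrow> 'o \<Rightarrow> 'o \<Rightarrow> bool" where
  "socle_diagram_arrow C M k A B \<longleftrightarrow> simple C A \<and> simple C B \<and> socle_layer_arrow C M k A B"

definition radical_diagram_arrow ::
  "('o, 'm, 'z) precat_scheme \<Rightarrow> 'o \<Rightarrow> nat \<Rightarrow> 'o \<Rightarrow> 'o \<Rightarrow> bool" where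
  "radical_diagram_arrow C M k A B \<longleftrightarrow> simple C A \<and> simple C B \<and> radical_layer_arrow C M k A B"


section \<open>Functors\<close>

locale cat_functor = source: category C + target: category D
  for C :: "('o, 'm, 'z) precat_scheme"
    and D :: "('p, 'n, 'y) precat_scheme"
    and Fo :: "'o \<Rightarrow> 'p" and Fa :: "'m \<Rightarrow> 'n" +
  assumes F_ob: "a \<in> Ob C \<Longrightarrow> Fo a \<in> Ob D"
    and F_hom: "f \<in> Hom C a b \<Longrightarrow> Fa f \<in> Hom D (Fo a) (Fo b)"
    and F_id: "a \<in> Ob C \<Longrightarrow> Fa (Id C a) = Id D (Fo a)"
    and F_comp: "\<lbrakk>f \<in> Hom C a b; g \<in> Hom C b c\<rbrakk>
                   \<Longrightarrow> Fa (g \<cdot>\<^bsub>C\<^esub> f) = Fa g \<cdot>\<^bsub>D\<^esub> Fa f"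

text \<open>Between abelian categories, a functor that preserves short exact sequences is
  automatically additive.\<close>

locale exact_functor = cat_functor +
  assumes F_exact: "short_exact C f g \<Longrightarrow> short_exact D (Fa f) (Fa g)"

locale strong_exact_functor = exact_functor +
  assumes F_strong: "short_exact C f g \<Longrightarrow> splits C f g \<longleftrightarrow> splits D (Fa f) (Fa g)"

definition preserves_socle_filtrations ::
  "('o, 'm, 'z) precat_scheme \<Rightarrow> ('p, 'n, 'y) precat_scheme \<Rightarrow> ('o \<Rightarrow> 'p) \<Rightarrow> bool" where
  "preserves_socle_filtrations C D Fo \<longleftrightarrow>
     (\<forall>X \<in> Ob C. \<forall>n. loewy_length C X n \<longrightarrow>
        loewy_length D (Fo X) n \<and>
        (\<forall>m. socle_filtration C X n m \<longrightarrow>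
           (\<exists>m'. socle_filtration D (Fo X) n m' \<and>
              (\<forall>k \<in> {1..n}. isomorphic D (Fo (Dom C (m k))) (Dom D (m' k))))))"

definition preserves_radical_filtrations ::
  "('o, 'm, 'z) precat_scheme \<Rightarrow> ('p, 'n, 'y) precat_scheme \<Rightarrow> ('o \<Rightarrow> 'p) \<Rightarrow> bool" where
  "preserves_radical_filtrations C D Fo \<longleftrightarrow>
     (\<forall>X \<in> Ob C. \<forall>n. loewy_length C X n \<longrightarrow>
        loewy_length D (Fo X) n \<and>
        (\<forall>m. radical_filtration C X n m \<longrightarrow>
           (\<exists>m'. radical_filtration D (Fo X) n m' \<and>
              (\<forall>k \<in> {1..n}. isomorphic D (Fo (Dom C (m k))) (Dom D (m' k))))))"

text \<open>The image of a simple object is semisimple but need not be simple: \<open>M \<mapsto> M \<oplus> M\<close> is strong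
  exact and preserves both filtrations. The arrow from \<open>F(A)\<close> to \<open>F(B)\<close> is therefore understood
  between factors of the layers of the diagram of \<open>F(X)\<close>, which need not be simple; when \<open>F(A)\<close>
  and \<open>F(B)\<close> are simple it is an arrow of the Loewy diagram of \<open>F(X)\<close>.\<close>

definition preserves_socle_diagrams ::
  "('o, 'm, 'z) precat_scheme \<Rightarrow> ('p, 'n, 'y) precat_scheme \<Rightarrow> ('o \<Rightarrow> 'p) \<Rightarrow> bool" where
  "preserves_socle_diagrams C D Fo \<longleftrightarrow>
     (\<forall>X \<in> Ob C. \<forall>k A B. socle_diagram_arrow C X k A B
        \<longrightarrow> socle_layer_arrow D (Fo X) k (Fo A) (Fo B))"

definition preserves_radical_diagrams ::
  "('o, 'm, 'z) precat_scheme \<Rightarrow> ('p, 'n, 'y) precat_scheme \<Rightarrow> ('o \<Rightarrow> 'p) \<Rightarrow> bool" where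
  "preserves_radical_diagrams C D Fo \<longleftrightarrow>
     (\<forall>X \<in> Ob C. \<forall>k A B. radical_diagram_arrow C X k A B
        \<longrightarrow> radical_layer_arrow D (Fo X) k (Fo A) (Fo B))"

end

theory Submission
  imports Defs
begin

text \<open>Let \<open>F\<close> be strong exact and preserve socle filtrations. Since Loewy lengths are preserved, \<open>F\<close>
  maps semisimple objects to semisimple objects, so by induction \<open>F(soc\<^sub>k(X)) \<subseteq> soc\<^sub>k(F(X))\<close>. Both
  sides are abstractly isomorphic, and \<open>F(X)\<close> is artinian because it has a finite series with
  semisimple quotients; as a monic endomorphism of an artinian object is invertible, the inclusion is
  an equality of subobjects. For radical filtrations the inclusion is the opposite one, and it uses
  that \<open>X/Rad(X)\<close> is semisimple. Once the filtrations agree as subobjects, exactness transports the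
  layers and their subquotients, and strong exactness the non-split extensions.\<close>

section \<open>Morphisms in abelian categories\<close>

text \<open>The preservation hypothesis only supplies abstract isomorphisms between the objects
  F(soc_k(X)) and soc_k(F(X)), whereas the arrows of a diagram depend on how these objects sit
  inside F(X). One inclusion together with an abstract isomorphism does not give equality in
  general, as 2Z inside Z shows. The target carries no finiteness assumption of its own, so no
  length function is at hand there, and the descending chain condition takes that role.
  Semisimplicity is recognised by length: the nonzero semisimple objects are exactly those of Loewy
  length 1, so they can be transported without any control over the images of simple objects.
  Semisimplicity of X/Rad(X) rests on descending chains as well: Z has zero radical and is not
  semisimple.\<close>

context category
begin

lemma in_HomD:
  assumes "f \<in> Hom C a b"
  shows "f \<in> Arr C" "Dom C f = a" "Cod C f = b" "a \<in> Ob C" "b \<in> Ob C"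
  using assms dom_in_Ob cod_in_Ob by (auto simp: Hom_def)

lemma Arr_in_Hom: "f \<in> Arr C \<Longrightarrow> f \<in> Hom C (Dom C f) (Cod C f)"
  by (simp add: Hom_def)

lemma monicI:
  assumes "f \<in> Hom C a b"
    and "\<And>x g h. \<lbrakk>g \<in> Hom C x a; h \<in> Hom C x a; f \<cdot> g = f \<cdot> h\<rbrakk> \<Longrightarrow> g = h"
  shows "monic C f"
  using assms in_HomD[OF assms(1)] unfolding monic_def by blast

lemma monicD:
  assumes "monic C f" "f \<in> Hom C a b" "g \<in> Hom C x a" "h \<in> Hom C x a" "f \<cdot> g = f \<cdot> h"
  shows "g = h"
  using assms in_HomD[OF assms(2)] unfolding monic_def by blast

lemma epicI:
  assumes "f \<in> Hom C a b"
    and "\<And>x g h. \<lbrakk>g \<in> Hom C b x; h \<in> Hom C b x; g \<cdot> f = h \<cdot> f\<rbrakk> \<Longrightarrow> g = h"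
  shows "epic C f"
  using assms in_HomD[OF assms(1)] unfolding epic_def by blast

lemma epicD:
  assumes "epic C f" "f \<in> Hom C a b" "g \<in> Hom C b x" "h \<in> Hom C b x" "g \<cdot> f = h \<cdot> f"
  shows "g = h"
  using assms in_HomD[OF assms(2)] unfolding epic_def by blast

lemma iso_arrI:
  assumes "f \<in> Hom C a b" "g \<in> Hom C b a" "g \<cdot> f = Id C a" "f \<cdot> g = Id C b"
  shows "iso_arr C f"
  using assms in_HomD[OF assms(1)] unfolding iso_arr_def by blast

lemma iso_arrE:
  assumes "iso_arr C f" "f \<in> Hom C a b"
  obtains g where "g \<in> Hom C b a" "g \<cdot> f = Id C a" "f \<cdot> g = Id C b"
  using assms in_HomD[OF assms(2)] unfolding iso_arr_def by blast

lemma isomorphic_sym: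
  assumes "isomorphic C a b"
  shows "isomorphic C b a"
proof -
  obtain f where f: "f \<in> Hom C a b" "iso_arr C f" using assms unfolding isomorphic_def by blast
  obtain g where g: "g \<in> Hom C b a" "g \<cdot> f = Id C a" "f \<cdot> g = Id C b"
    by (rule iso_arrE[OF f(2,1)])
  then show ?thesis using iso_arrI[OF g(1) f(1) g(3,2)] unfolding isomorphic_def by blast
qed

lemma iso_arr_Id: "a \<in> Ob C \<Longrightarrow> iso_arr C (Id C a)"
  by (rule iso_arrI[OF id_in_Hom id_in_Hom]) (simp_all add: comp_id_left[OF id_in_Hom])

lemma iso_arr_monic:
  assumes "iso_arr C f"
  shows "monic C f"
proof -
  have f: "f \<in> Hom C (Dom C f) (Cod C f)"
    using assms by (simp add: iso_arr_def Arr_in_Hom)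
  obtain g where g: "g \<in> Hom C (Cod C f) (Dom C f)" "g \<cdot> f = Id C (Dom C f)"
    by (rule iso_arrE[OF assms f])
  show ?thesis
    by (rule monicI[OF f]) (metis comp_assoc[OF _ f g(1)] g(2) comp_id_left)
qed

lemma monic_comp:
  assumes "monic C f" "f \<in> Hom C b c" "monic C g" "g \<in> Hom C a b"
  shows "monic C (f \<cdot> g)"
proof (rule monicI[OF comp_in_Hom[OF assms(4,2)]])
  fix x h k assume h: "h \<in> Hom C x a" "k \<in> Hom C x a" "(f \<cdot> g) \<cdot> h = (f \<cdot> g) \<cdot> k"
  then have "f \<cdot> (g \<cdot> h) = f \<cdot> (g \<cdot> k)"
    by (simp add: comp_assoc[OF _ assms(4,2)])
  then have "g \<cdot> h = g \<cdot> k"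
    using monicD[OF assms(1,2) comp_in_Hom[OF h(1) assms(4)] comp_in_Hom[OF h(2) assms(4)]] by simp
  then show "h = k" using monicD[OF assms(3,4) h(1,2)] by simp
qed

lemma monic_of_comp:
  assumes "monic C (f \<cdot> g)" "f \<in> Hom C b c" "g \<in> Hom C a b"
  shows "monic C g"
proof (rule monicI[OF assms(3)])
  fix x h k assume h: "h \<in> Hom C x a" "k \<in> Hom C x a" "g \<cdot> h = g \<cdot> k"
  then have "(f \<cdot> g) \<cdot> h = (f \<cdot> g) \<cdot> k"
    by (simp add: comp_assoc[OF _ assms(3,2), symmetric])
  then show "h = k"
    by (rule monicD[OF assms(1) comp_in_Hom[OF assms(3,2)] h(1,2)])
qed

lemma subobject_in_Hom: "subobject C M s \<Longrightarrow> s \<in> Hom C (Dom C s) M"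
  by (auto simp: subobject_def monic_def Hom_def)

lemma subobjectI: "\<lbrakk>monic C s; s \<in> Hom C a M\<rbrakk> \<Longrightarrow> subobject C M s"
  by (auto simp: subobject_def Hom_def)

lemma subobject_monic: "subobject C M s \<Longrightarrow> monic C s"
  by (simp add: subobject_def)

lemma sub_leI:
  assumes "s \<in> Hom C a M" "t \<in> Hom C b M" "u \<in> Hom C a b" "t \<cdot> u = s"
  shows "sub_le C s t"
  using assms(3,4) in_HomD[OF assms(1)] in_HomD[OF assms(2)] unfolding sub_le_def by blast

lemma sub_leE:
  assumes "sub_le C s t" "s \<in> Hom C a M" "t \<in> Hom C b M"
  obtains u where "u \<in> Hom C a b" "t \<cdot> u = s"
  using assms(1) in_HomD[OF assms(2)] in_HomD[OF assms(3)] unfolding sub_le_def by blast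

lemma sub_le_trans:
  assumes "sub_le C s t" "sub_le C t v" "s \<in> Hom C a M" "t \<in> Hom C b M" "v \<in> Hom C c M"
  shows "sub_le C s v"
proof -
  obtain u where u: "u \<in> Hom C a b" "t \<cdot> u = s"
    by (rule sub_leE[OF assms(1,3,4)])
  obtain w where w: "w \<in> Hom C b c" "v \<cdot> w = t"
    by (rule sub_leE[OF assms(2,4,5)])
  have "v \<cdot> (w \<cdot> u) = s"
    using comp_assoc[OF u(1) w(1) assms(5)] u(2) w(2) by simp
  then show ?thesis
    by (rule sub_leI[OF assms(3,5) comp_in_Hom[OF u(1) w(1)]])
qed

text \<open>Subobjects are only preordered, so equality of subobjects is used in the form of a
  mutually inverse pair of comparison morphisms; cancelling the monomorphisms \<open>s\<close> and
  \<open>t\<close> shows that the composites are identities.\<close>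

lemma sub_le_antisym:
  assumes "sub_le C s t" "sub_le C t s" "subobject C M s" "subobject C M t"
    and "s \<in> Hom C a M" "t \<in> Hom C b M"
  obtains u v where "u \<in> Hom C a b" "v \<in> Hom C b a" "t \<cdot> u = s" "s \<cdot> v = t"
    "v \<cdot> u = Id C a" "u \<cdot> v = Id C b"
proof -
  obtain u where u: "u \<in> Hom C a b" "t \<cdot> u = s"
    by (rule sub_leE[OF assms(1,5,6)])
  obtain v where v: "v \<in> Hom C b a" "s \<cdot> v = t"
    by (rule sub_leE[OF assms(2,6,5)])
  have Id: "Id C a \<in> Hom C a a" "Id C b \<in> Hom C b b"
    using in_HomD[OF assms(5)] in_HomD[OF assms(6)] id_in_Hom by auto
  have "s \<cdot> (v \<cdot> u) = s \<cdot> Id C a"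
    using comp_assoc[OF u(1) v(1) assms(5)] u v comp_id_right[OF assms(5)] by simp
  then have 1: "v \<cdot> u = Id C a"
    by (rule monicD[OF subobject_monic[OF assms(3)] assms(5) comp_in_Hom[OF u(1) v(1)] Id(1)])
  have "t \<cdot> (u \<cdot> v) = t \<cdot> Id C b"
    using comp_assoc[OF v(1) u(1) assms(6)] u v comp_id_right[OF assms(6)] by simp
  then have 2: "u \<cdot> v = Id C b"
    by (rule monicD[OF subobject_monic[OF assms(4)] assms(6) comp_in_Hom[OF v(1) u(1)] Id(2)])
  show thesis using that[OF u(1) v(1) u(2) v(2) 1 2] .
qed

end

section \<open>Zero morphisms, kernels and cokernels in a preadditive category\<close>

context preadditive_category
begin

lemma Zero_in_Hom: "\<lbrakk>a \<in> Ob C; b \<in> Ob C\<rbrakk> \<Longrightarrow> Zero C a b \<in> Hom C a b"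
  using abelian_monoid.zero_closed[OF abelian_group.axioms(1)[OF hom_abelian_group]]
  by (simp add: hom_group_def)

lemma Add_Zero_left: "f \<in> Hom C a b \<Longrightarrow> Add C (Zero C a b) f = f"
  using abelian_monoid.l_zero[OF abelian_group.axioms(1)[OF hom_abelian_group], of a b f] in_HomD[of f a b]
  by (simp add: hom_group_def)

lemma Add_right_cancel:
  assumes "f \<in> Hom C a b" "g \<in> Hom C a b" "h \<in> Hom C a b" "Add C f h = Add C g h"
  shows "f = g"
proof -
  interpret G: abelian_group "hom_group C a b"
    using hom_abelian_group in_HomD[OF assms(1)] by blast
  show ?thesis
    using G.add.right_cancel[of h f g] assms by (simp add: hom_group_def)
qed

lemma ex_difference:
  assumes "f \<in> Hom C a b" "g \<in> Hom C a b"
  obtains d where "d \<in> Hom C a b" "Add C d g = f"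
proof -
  interpret G: abelian_group "hom_group C a b"
    using hom_abelian_group in_HomD[OF assms(1)] by blast
  let ?d = "f \<ominus>\<^bsub>hom_group C a b\<^esub> g"
  have car: "carrier (hom_group C a b) = Hom C a b" and add: "add (hom_group C a b) = Add C"
    by (simp_all add: hom_group_def)
  have "?d \<in> Hom C a b" using G.minus_closed[of f g] assms car by auto
  moreover have "?d \<oplus>\<^bsub>hom_group C a b\<^esub> g = f"
    using assms car by (metis G.minus_eq G.a_assoc G.a_inv_closed G.l_neg G.r_zero)
  ultimately show thesis using that add by simp
qed

text \<open>The axioms give distributivity over sums only; absorption of zero follows from 0 + 0 = 0
  by cancellation.\<close>

lemma comp_Zero_right:
  assumes "g \<in> Hom C b c" "a \<in> Ob C"
  shows "g \<cdot> Zero C a b = Zero C a c"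
proof -
  have z: "Zero C a b \<in> Hom C a b" "Zero C a c \<in> Hom C a c"
    using Zero_in_Hom assms(2) in_HomD[OF assms(1)] by auto
  have "g \<cdot> Add C (Zero C a b) (Zero C a b) = Add C (g \<cdot> Zero C a b) (g \<cdot> Zero C a b)"
    by (rule comp_add_right[OF z(1) z(1) assms(1)])
  then have "Add C (Zero C a c) (g \<cdot> Zero C a b) = Add C (g \<cdot> Zero C a b) (g \<cdot> Zero C a b)"
    using Add_Zero_left[OF z(1)] Add_Zero_left[OF comp_in_Hom[OF z(1) assms(1)]] by simp
  then show ?thesis
    using Add_right_cancel[OF z(2) comp_in_Hom[OF z(1) assms(1)] comp_in_Hom[OF z(1) assms(1)]] by simp
qed

lemma comp_Zero_left:
  assumes "g \<in> Hom C a b" "c \<in> Ob C"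
  shows "Zero C b c \<cdot> g = Zero C a c"
proof -
  have z: "Zero C b c \<in> Hom C b c" "Zero C a c \<in> Hom C a c"
    using Zero_in_Hom assms(2) in_HomD[OF assms(1)] by auto
  have "Add C (Zero C b c) (Zero C b c) \<cdot> g = Add C (Zero C b c \<cdot> g) (Zero C b c \<cdot> g)"
    by (rule comp_add_left[OF assms(1) z(1) z(1)])
  then have "Add C (Zero C a c) (Zero C b c \<cdot> g) = Add C (Zero C b c \<cdot> g) (Zero C b c \<cdot> g)"
    using Add_Zero_left[OF z(1)] Add_Zero_left[OF comp_in_Hom[OF assms(1) z(1)]] by simp
  then show ?thesis
    using Add_right_cancel[OF z(2) comp_in_Hom[OF assms(1) z(1)] comp_in_Hom[OF assms(1) z(1)]] by simp
qed

text \<open>If \<open>f\<close> equalises \<open>g\<close> and \<open>h\<close>, it kills their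
  difference; so left cancellation need only be tested against zero.\<close>

lemma monic_ZeroI:
  assumes f: "f \<in> Hom C a b"
    and *: "\<And>x g. \<lbrakk>g \<in> Hom C x a; f \<cdot> g = Zero C x b\<rbrakk> \<Longrightarrow> g = Zero C x a"
  shows "monic C f"
proof (rule monicI[OF f])
  fix x g h assume g: "g \<in> Hom C x a" "h \<in> Hom C x a" "f \<cdot> g = f \<cdot> h"
  obtain d where d: "d \<in> Hom C x a" "Add C d h = g" by (rule ex_difference[OF g(1,2)])
  have fh: "f \<cdot> h \<in> Hom C x b" and fd: "f \<cdot> d \<in> Hom C x b"
    using comp_in_Hom f g(2) d(1) by auto
  have z: "Zero C x b \<in> Hom C x b" using Zero_in_Hom in_HomD[OF fh] by auto
  have "Add C (f \<cdot> d) (f \<cdot> h) = Add C (Zero C x b) (f \<cdot> h)"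
    using comp_add_right[OF d(1) g(2) f] d(2) g(3) Add_Zero_left[OF fh] by simp
  then have "f \<cdot> d = Zero C x b"
    by (rule Add_right_cancel[OF fd z fh])
  then have "d = Zero C x a" by (rule *[OF d(1)])
  then show "g = h" using d Add_Zero_left[OF g(2)] by simp
qed

lemma monic_ZeroD:
  assumes "monic C f" "f \<in> Hom C a b" "g \<in> Hom C x a" "f \<cdot> g = Zero C x b"
  shows "g = Zero C x a"
proof -
  have x: "x \<in> Ob C" "a \<in> Ob C" using in_HomD[OF assms(3)] by auto
  then show ?thesis
    using monicD[OF assms(1-3) Zero_in_Hom[OF x]] assms(4) comp_Zero_right[OF assms(2) x(1)] by simp
qed

lemma epic_ZeroI:
  assumes f: "f \<in> Hom C a b"
    and *: "\<And>x g. \<lbrakk>g \<in> Hom C b x; g \<cdot> f = Zero C a x\<rbrakk> \<Longrightarrow> g = Zero C b x"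
  shows "epic C f"
proof (rule epicI[OF f])
  fix x g h assume g: "g \<in> Hom C b x" "h \<in> Hom C b x" "g \<cdot> f = h \<cdot> f"
  obtain d where d: "d \<in> Hom C b x" "Add C d h = g" by (rule ex_difference[OF g(1,2)])
  have fh: "h \<cdot> f \<in> Hom C a x" and fd: "d \<cdot> f \<in> Hom C a x"
    using comp_in_Hom f g(2) d(1) by auto
  have z: "Zero C a x \<in> Hom C a x" using Zero_in_Hom in_HomD[OF fh] by auto
  have "Add C (d \<cdot> f) (h \<cdot> f) = Add C (Zero C a x) (h \<cdot> f)"
    using comp_add_left[OF f d(1) g(2)] d(2) g(3) Add_Zero_left[OF fh] by simp
  then have "d \<cdot> f = Zero C a x"
    by (rule Add_right_cancel[OF fd z fh])
  then have "d = Zero C b x" by (rule *[OF d(1)])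
  then show "g = h" using d Add_Zero_left[OF g(2)] by simp
qed

lemma epic_ZeroD:
  assumes "epic C f" "f \<in> Hom C a b" "g \<in> Hom C b x" "g \<cdot> f = Zero C a x"
  shows "g = Zero C b x"
proof -
  have x: "x \<in> Ob C" "b \<in> Ob C" using in_HomD[OF assms(3)] by auto
  then show ?thesis
    using epicD[OF assms(1-3) Zero_in_Hom[OF x(2,1)]] assms(4) comp_Zero_left[OF assms(2) x(1)] by simp
qed

lemma kernel_in_Hom: "\<lbrakk>is_kernel C f k; f \<in> Hom C a b\<rbrakk> \<Longrightarrow> k \<in> Hom C (Dom C k) a"
  by (auto simp: is_kernel_def Hom_def)

lemma kernel_comp: "\<lbrakk>is_kernel C f k; f \<in> Hom C a b; k \<in> Hom C c a\<rbrakk> \<Longrightarrow> f \<cdot> k = Zero C c b"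
  by (auto simp: is_kernel_def Hom_def)

lemma kernel_factor:
  assumes "is_kernel C f k" "f \<in> Hom C a b" "k \<in> Hom C c a"
    and "g \<in> Hom C x a" "f \<cdot> g = Zero C x b"
  obtains u where "u \<in> Hom C x c" "k \<cdot> u = g"
  using assms in_HomD[OF assms(2)] in_HomD[OF assms(3)] unfolding is_kernel_def by blast

lemma kernel_monic:
  assumes "is_kernel C f k"
  shows "monic C k"
proof -
  have f: "f \<in> Hom C (Dom C f) (Cod C f)" and k: "k \<in> Hom C (Dom C k) (Dom C f)"
    using assms by (auto simp: is_kernel_def Hom_def)
  show ?thesis
  proof (rule monicI[OF k])
    fix x g h assume g: "g \<in> Hom C x (Dom C k)" "h \<in> Hom C x (Dom C k)" "k \<cdot> g = k \<cdot> h"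
    have kg: "k \<cdot> g \<in> Hom C x (Dom C f)" by (rule comp_in_Hom[OF g(1) k])
    have "f \<cdot> (k \<cdot> g) = Zero C x (Cod C f)"
      using comp_assoc[OF g(1) k f] kernel_comp[OF assms f k] comp_Zero_left[OF g(1)] in_HomD[OF f] by simp
    then have "\<exists>!u. u \<in> Hom C x (Dom C k) \<and> k \<cdot> u = k \<cdot> g"
      using assms kg unfolding is_kernel_def by blast
    then show "g = h" using g by metis
  qed
qed

lemma is_kernelI:
  assumes "f \<in> Hom C a b" "k \<in> Hom C c a" "monic C k" "f \<cdot> k = Zero C c b"
    and "\<And>x g. \<lbrakk>g \<in> Hom C x a; f \<cdot> g = Zero C x b\<rbrakk> \<Longrightarrow> \<exists>u \<in> Hom C x c. k \<cdot> u = g"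
  shows "is_kernel C f k"
proof -
  have "\<exists>!u. u \<in> Hom C x c \<and> k \<cdot> u = g" if "g \<in> Hom C x a" "f \<cdot> g = Zero C x b" for x g
    using assms(5)[OF that] monicD[OF assms(3,2)] by metis
  then show ?thesis
    using in_HomD[OF assms(1)] in_HomD[OF assms(2)] assms(4) unfolding is_kernel_def by auto
qed

lemma cokernel_in_Hom: "\<lbrakk>is_cokernel C f q; f \<in> Hom C a b\<rbrakk> \<Longrightarrow> q \<in> Hom C b (Cod C q)"
  by (auto simp: is_cokernel_def Hom_def)

lemma cokernel_comp: "\<lbrakk>is_cokernel C f q; f \<in> Hom C a b; q \<in> Hom C b c\<rbrakk> \<Longrightarrow> q \<cdot> f = Zero C a c"
  by (auto simp: is_cokernel_def Hom_def)

lemma cokernel_factor: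
  assumes "is_cokernel C f q" "f \<in> Hom C a b" "q \<in> Hom C b c"
    and "g \<in> Hom C b x" "g \<cdot> f = Zero C a x"
  obtains u where "u \<in> Hom C c x" "u \<cdot> q = g"
  using assms in_HomD[OF assms(2)] in_HomD[OF assms(3)] unfolding is_cokernel_def by blast

lemma cokernel_epic:
  assumes "is_cokernel C f q"
  shows "epic C q"
proof -
  have f: "f \<in> Hom C (Dom C f) (Cod C f)" and q: "q \<in> Hom C (Cod C f) (Cod C q)"
    using assms by (auto simp: is_cokernel_def Hom_def)
  show ?thesis
  proof (rule epicI[OF q])
    fix x g h assume g: "g \<in> Hom C (Cod C q) x" "h \<in> Hom C (Cod C q) x" "g \<cdot> q = h \<cdot> q"
    have gq: "g \<cdot> q \<in> Hom C (Cod C f) x" by (rule comp_in_Hom[OF q g(1)])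
    have "(g \<cdot> q) \<cdot> f = Zero C (Dom C f) x"
      using comp_assoc[OF f q g(1)] cokernel_comp[OF assms f q] comp_Zero_right[OF g(1)] in_HomD[OF f] by simp
    then have "\<exists>!u. u \<in> Hom C (Cod C q) x \<and> u \<cdot> q = g \<cdot> q"
      using assms gq unfolding is_cokernel_def by blast
    then show "g = h" using g by metis
  qed
qed

lemma is_cokernelI:
  assumes "f \<in> Hom C a b" "q \<in> Hom C b c" "epic C q" "q \<cdot> f = Zero C a c"
    and "\<And>x g. \<lbrakk>g \<in> Hom C b x; g \<cdot> f = Zero C a x\<rbrakk> \<Longrightarrow> \<exists>u \<in> Hom C c x. u \<cdot> q = g"
  shows "is_cokernel C f q"
proof -
  have "\<exists>!u. u \<in> Hom C c x \<and> u \<cdot> q = g" if "g \<in> Hom C b x" "g \<cdot> f = Zero C a x" for x g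
    using assms(5)[OF that] epicD[OF assms(3,2)] by metis
  then show ?thesis
    using in_HomD[OF assms(1)] in_HomD[OF assms(2)] assms(4) unfolding is_cokernel_def by auto
qed

text \<open>One equation replaces the two universal properties: any \<open>f\<close> out of or into
  \<open>z\<close> equals its composite with the identity, hence with zero. This equational form is
  what a functor can transport.\<close>

lemma zero_object_iff: "zero_object C z \<longleftrightarrow> z \<in> Ob C \<and> Id C z = Zero C z z"
proof
  assume "zero_object C z"
  then have "z \<in> Ob C" "\<exists>!f. f \<in> Hom C z z" by (auto simp: zero_object_def)
  then show "z \<in> Ob C \<and> Id C z = Zero C z z"
    using id_in_Hom Zero_in_Hom by blast
next
  assume z: "z \<in> Ob C \<and> Id C z = Zero C z z"
  have "f = Zero C z a" if "f \<in> Hom C z a" for f a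
    using comp_id_right[OF that] comp_Zero_right[OF that] z by simp
  moreover have "f = Zero C a z" if "f \<in> Hom C a z" for f a
    using comp_id_left[OF that] comp_Zero_left[OF that] z by simp
  ultimately show "zero_object C z"
    using Zero_in_Hom z unfolding zero_object_def by metis
qed

lemma zero_object_from: "\<lbrakk>zero_object C z; f \<in> Hom C z a\<rbrakk> \<Longrightarrow> f = Zero C z a"
  using comp_id_right[of f z a] comp_Zero_right[of f z a z] by (simp add: zero_object_iff)

lemma zero_object_to: "\<lbrakk>zero_object C z; f \<in> Hom C a z\<rbrakk> \<Longrightarrow> f = Zero C a z"
  using comp_id_left[of f a z] comp_Zero_left[of f a z z] by (simp add: zero_object_iff)

lemma monic_Zero_imp_zero_object:
  assumes "monic C (Zero C a b)" "a \<in> Ob C" "b \<in> Ob C"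
  shows "zero_object C a"
  using monic_ZeroD[OF assms(1) Zero_in_Hom[OF assms(2,3)] id_in_Hom[OF assms(2)]]
    comp_Zero_left[OF id_in_Hom[OF assms(2)] assms(3)] assms(2) by (simp add: zero_object_iff)

lemma zero_object_monic:
  assumes "zero_object C z" "b \<in> Ob C"
  shows "monic C (Zero C z b)"
proof (rule monicI[OF Zero_in_Hom])
  fix x g h assume "g \<in> Hom C x z" "h \<in> Hom C x z"
  then show "g = h" using zero_object_to[OF assms(1)] by metis
qed (use assms in \<open>auto simp: zero_object_def\<close>)

lemma zero_object_sub_le:
  assumes "zero_object C (Dom C s)" "s \<in> Hom C a M" "t \<in> Hom C b M"
  shows "sub_le C s t"
proof -
  have a: "a \<in> Ob C" "b \<in> Ob C" "zero_object C a"
    using in_HomD[OF assms(2)] in_HomD[OF assms(3)] assms(1) by auto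
  have "t \<cdot> Zero C a b = s"
    using comp_Zero_right[OF assms(3) a(1)] zero_object_from[OF a(3) assms(2)] by simp
  then show ?thesis by (rule sub_leI[OF assms(2,3) Zero_in_Hom[OF a(1,2)]])
qed

end

section \<open>Normality of monomorphisms and epimorphisms, and images in simple objects\<close>

context abelian_category
begin

lemma ex_kernel:
  assumes "f \<in> Hom C a b"
  obtains k c where "is_kernel C f k" "k \<in> Hom C c a"
  using kernels[of f] kernel_in_Hom[OF _ assms] in_HomD[OF assms] by blast

lemma ex_cokernel:
  assumes "f \<in> Hom C a b"
  obtains q c where "is_cokernel C f q" "q \<in> Hom C b c"
  using cokernels[of f] cokernel_in_Hom[OF _ assms] in_HomD[OF assms] by blast

text \<open>By normality \<open>f\<close> is the kernel of some \<open>g\<close>. Since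
  \<open>g\<close> kills \<open>f\<close>, it factors through the cokernel \<open>q\<close>, so
  whatever \<open>q\<close> kills is killed by \<open>g\<close> and therefore factors through
  \<open>f\<close>.\<close>

lemma monic_kernel_of_cokernel:
  assumes "monic C f" "f \<in> Hom C a b" "is_cokernel C f q" "q \<in> Hom C b c"
  shows "is_kernel C q f"
proof -
  obtain g where g: "is_kernel C g f" using monic_normal[OF assms(1)] by blast
  then have gH: "g \<in> Hom C b (Cod C g)"
    using in_HomD[OF assms(2)] by (auto simp: is_kernel_def Hom_def)
  obtain h where h: "h \<in> Hom C c (Cod C g)" "h \<cdot> q = g"
    by (rule cokernel_factor[OF assms(3,2,4) gH kernel_comp[OF g gH assms(2)]])
  show ?thesis
  proof (rule is_kernelI[OF assms(4,2,1) cokernel_comp[OF assms(3,2,4)]])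
    fix x y assume y: "y \<in> Hom C x b" "q \<cdot> y = Zero C x c"
    have "g \<cdot> y = Zero C x (Cod C g)"
      using comp_assoc[OF y(1) assms(4) h(1)] h y comp_Zero_right[OF h(1)] in_HomD[OF y(1)] by simp
    then show "\<exists>u \<in> Hom C x a. f \<cdot> u = y"
      using kernel_factor[OF g gH assms(2) y(1)] by blast
  qed
qed

lemma epic_cokernel_of_kernel:
  assumes "epic C f" "f \<in> Hom C a b" "is_kernel C f k" "k \<in> Hom C c a"
  shows "is_cokernel C k f"
proof -
  obtain g where g: "is_cokernel C g f" using epic_normal[OF assms(1)] by blast
  then have gH: "g \<in> Hom C (Dom C g) a"
    using in_HomD[OF assms(2)] by (auto simp: is_cokernel_def Hom_def)
  obtain h where h: "h \<in> Hom C (Dom C g) c" "k \<cdot> h = g"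
    by (rule kernel_factor[OF assms(3,2,4) gH cokernel_comp[OF g gH assms(2)]])
  show ?thesis
  proof (rule is_cokernelI[OF assms(4,2,1) kernel_comp[OF assms(3,2,4)]])
    fix x y assume y: "y \<in> Hom C a x" "y \<cdot> k = Zero C c x"
    have "y \<cdot> g = Zero C (Dom C g) x"
      using comp_assoc[OF h(1) assms(4) y(1)] h y comp_Zero_left[OF h(1)] in_HomD[OF y(1)] by simp
    then show "\<exists>u \<in> Hom C b x. u \<cdot> f = y"
      using cokernel_factor[OF g gH assms(2) y(1)] by blast
  qed
qed

text \<open>The cokernel of an epimorphism is zero, so the identity of the codomain lies in the
  kernel of that cokernel, which is \<open>f\<close> itself. This yields a right inverse, and
  \<open>f\<close> being monic makes it two-sided.\<close>

lemma monic_epic_iso: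
  assumes "monic C f" "epic C f" "f \<in> Hom C a b"
  shows "iso_arr C f"
proof -
  obtain q c where q: "is_cokernel C f q" "q \<in> Hom C b c" by (rule ex_cokernel[OF assms(3)])
  have ob: "b \<in> Ob C" "c \<in> Ob C" "a \<in> Ob C" using in_HomD[OF q(2)] in_HomD[OF assms(3)] by auto
  have "q = Zero C b c"
    by (rule epic_ZeroD[OF assms(2,3) q(2) cokernel_comp[OF q(1) assms(3) q(2)]])
  then have "q \<cdot> Id C b = Zero C b c" using comp_id_right[OF q(2)] by simp
  then obtain u where u: "u \<in> Hom C b a" "f \<cdot> u = Id C b"
    by (rule kernel_factor[OF monic_kernel_of_cokernel[OF assms(1,3) q] q(2) assms(3) id_in_Hom[OF ob(1)]])
  have "f \<cdot> (u \<cdot> f) = f \<cdot> Id C a"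
    using comp_assoc[OF assms(3) u(1) assms(3)] u(2) comp_id_left[OF assms(3)] comp_id_right[OF assms(3)] by simp
  then have "u \<cdot> f = Id C a"
    by (rule monicD[OF assms(1,3) comp_in_Hom[OF assms(3) u(1)] id_in_Hom[OF ob(3)]])
  then show ?thesis using iso_arrI[OF assms(3) u(1)] u(2) by simp
qed

text \<open>Half of Schur's lemma: the image of \<open>f\<close>, realised as the kernel
  \<open>k\<close> of its cokernel, is a nonzero subobject of \<open>S\<close> and hence everything,
  so the cokernel vanishes.\<close>

lemma to_simple_epic:
  assumes "simple C S" "f \<in> Hom C a S" "f \<noteq> Zero C a S"
  shows "epic C f"
proof -
  obtain q c where q: "is_cokernel C f q" "q \<in> Hom C S c" by (rule ex_cokernel[OF assms(2)])
  obtain k d where k: "is_kernel C q k" "k \<in> Hom C d S" by (rule ex_kernel[OF q(2)])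
  have sub: "subobject C S k" by (rule subobjectI[OF kernel_monic[OF k(1)] k(2)])
  obtain u where u: "u \<in> Hom C a d" "k \<cdot> u = f"
    by (rule kernel_factor[OF k(1) q(2) k(2) assms(2) cokernel_comp[OF q(1) assms(2) q(2)]])
  have ob: "d \<in> Ob C" "S \<in> Ob C" "a \<in> Ob C" "c \<in> Ob C"
    using in_HomD[OF k(2)] in_HomD[OF u(1)] in_HomD[OF q(2)] by auto
  have "\<not> zero_object C d"
  proof
    assume z: "zero_object C d"
    have "f = Zero C a S"
      using u zero_object_to[OF z u(1)] comp_Zero_right[OF k(2) ob(3)] by simp
    then show False using assms(3) by simp
  qed
  then have "iso_arr C k"
    using assms(1) sub in_HomD[OF k(2)] unfolding simple_def by blast
  then obtain v where v: "v \<in> Hom C S d" "k \<cdot> v = Id C S"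
    using iso_arrE[OF _ k(2)] by blast
  have "q = q \<cdot> (k \<cdot> v)" using v comp_id_right[OF q(2)] by simp
  also have "\<dots> = Zero C S c"
    using comp_assoc[OF v(1) k(2) q(2)] kernel_comp[OF k(1) q(2) k(2)] comp_Zero_left[OF v(1) ob(4)] by simp
  finally have q0: "q = Zero C S c" .
  show ?thesis
  proof (rule epic_ZeroI[OF assms(2)])
    fix x g assume g: "g \<in> Hom C S x" "g \<cdot> f = Zero C a x"
    obtain w where w: "w \<in> Hom C c x" "w \<cdot> q = g"
      by (rule cokernel_factor[OF q(1) assms(2) q(2) g])
    then show "g = Zero C S x" using q0 comp_Zero_right[OF w(1) ob(2)] by simp
  qed
qed

end

section \<open>Semisimple objects\<close>

context preadditive_category
begin

section \<open>Finite sums of parallel morphisms\<close>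

lemma finsum_in_Hom:
  fixes n :: nat
  assumes "\<And>i. i < n \<Longrightarrow> f i \<in> Hom C a b" "a \<in> Ob C" "b \<in> Ob C"
  shows "finsum (hom_group C a b) f {..<n} \<in> Hom C a b"
proof -
  interpret G: abelian_group "hom_group C a b"
    using hom_abelian_group assms by blast
  show ?thesis
    using G.finsum_closed[of f "{..<n}"] assms(1) by (auto simp: hom_group_def Pi_def)
qed

lemma finsum_Suc_hom:
  fixes n :: nat
  assumes "\<And>i. i < Suc n \<Longrightarrow> f i \<in> Hom C a b" "a \<in> Ob C" "b \<in> Ob C"
  shows "finsum (hom_group C a b) f {..<Suc n} = Add C (f n) (finsum (hom_group C a b) f {..<n})"
proof -
  interpret G: abelian_group "hom_group C a b"
    using hom_abelian_group assms by blast
  show ?thesis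
    using G.finsum_insert[of "{..<n}" n f] assms(1)
    by (auto simp: lessThan_Suc hom_group_def Pi_def)
qed

lemma finsum_0_hom:
  assumes "a \<in> Ob C" "b \<in> Ob C"
  shows "finsum (hom_group C a b) f {..<0::nat} = Zero C a b"
proof -
  interpret G: abelian_group "hom_group C a b"
    using hom_abelian_group assms by blast
  show ?thesis
    using G.finsum_empty[of f] by (simp add: hom_group_def)
qed

lemma finsum_cong_hom:
  fixes n :: nat
  assumes "\<And>i. i < n \<Longrightarrow> g i \<in> Hom C a b" "\<And>i. i < n \<Longrightarrow> f i = g i" "a \<in> Ob C" "b \<in> Ob C"
  shows "finsum (hom_group C a b) f {..<n} = finsum (hom_group C a b) g {..<n}"
proof -
  interpret G: abelian_group "hom_group C a b"
    using hom_abelian_group assms by blast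
  show ?thesis
    by (rule G.finsum_cong') (use assms(1,2) in \<open>auto simp: hom_group_def Pi_def\<close>)
qed

lemma finsum_comp_left:
  fixes n :: nat
  assumes "\<And>i. i < n \<Longrightarrow> f i \<in> Hom C a b" "a \<in> Ob C" "g \<in> Hom C b c"
  shows "g \<cdot> finsum (hom_group C a b) f {..<n} = finsum (hom_group C a c) (\<lambda>i. g \<cdot> f i) {..<n}"
  using assms(1)
proof (induction n)
  case 0
  then show ?case
    using finsum_0_hom comp_Zero_right[OF assms(3,2)] in_HomD[OF assms(3)] assms(2) by simp
next
  case (Suc n)
  have ob: "b \<in> Ob C" "c \<in> Ob C" using in_HomD[OF assms(3)] by auto
  have S: "finsum (hom_group C a b) f {..<n} \<in> Hom C a b"
    by (rule finsum_in_Hom[OF _ assms(2) ob(1)]) (use Suc.prems in auto)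
  have "g \<cdot> finsum (hom_group C a b) f {..<Suc n}
      = g \<cdot> Add C (f n) (finsum (hom_group C a b) f {..<n})"
    by (subst finsum_Suc_hom[OF Suc.prems assms(2) ob(1)]) simp_all
  also have "\<dots> = Add C (g \<cdot> f n) (g \<cdot> finsum (hom_group C a b) f {..<n})"
    by (rule comp_add_right[OF _ S assms(3)]) (use Suc.prems in auto)
  also have "\<dots> = Add C (g \<cdot> f n) (finsum (hom_group C a c) (\<lambda>i. g \<cdot> f i) {..<n})"
    using Suc by simp
  also have "\<dots> = finsum (hom_group C a c) (\<lambda>i. g \<cdot> f i) {..<Suc n}"
    by (rule finsum_Suc_hom[symmetric, OF _ assms(2) ob(2)])
      (use comp_in_Hom[OF _ assms(3)] Suc.prems in blast)
  finally show ?case .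
qed

lemma finsum_comp_right:
  fixes n :: nat
  assumes "\<And>i. i < n \<Longrightarrow> f i \<in> Hom C b c" "c \<in> Ob C" "g \<in> Hom C a b"
  shows "finsum (hom_group C b c) f {..<n} \<cdot> g = finsum (hom_group C a c) (\<lambda>i. f i \<cdot> g) {..<n}"
  using assms(1)
proof (induction n)
  case 0
  then show ?case
    using finsum_0_hom comp_Zero_left[OF assms(3,2)] in_HomD[OF assms(3)] assms(2) by simp
next
  case (Suc n)
  have ob: "a \<in> Ob C" "b \<in> Ob C" using in_HomD[OF assms(3)] by auto
  have S: "finsum (hom_group C b c) f {..<n} \<in> Hom C b c"
    by (rule finsum_in_Hom[OF _ ob(2) assms(2)]) (use Suc.prems in auto)
  have "finsum (hom_group C b c) f {..<Suc n} \<cdot> g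
      = Add C (f n) (finsum (hom_group C b c) f {..<n}) \<cdot> g"
    by (subst finsum_Suc_hom[OF Suc.prems ob(2) assms(2)]) simp_all
  also have "\<dots> = Add C (f n \<cdot> g) (finsum (hom_group C b c) f {..<n} \<cdot> g)"
    by (rule comp_add_left[OF assms(3) _ S]) (use Suc.prems in auto)
  also have "\<dots> = Add C (f n \<cdot> g) (finsum (hom_group C a c) (\<lambda>i. f i \<cdot> g) {..<n})"
    using Suc by simp
  also have "\<dots> = finsum (hom_group C a c) (\<lambda>i. f i \<cdot> g) {..<Suc n}"
    by (rule finsum_Suc_hom[symmetric, OF _ ob(1) assms(2)])
      (use comp_in_Hom[OF assms(3)] Suc.prems in blast)
  finally show ?case .
qed

lemma finsum_single:
  fixes n :: nat
  assumes "j < n" "f j \<in> Hom C a b" "\<And>i. \<lbrakk>i < n; i \<noteq> j\<rbrakk> \<Longrightarrow> f i = Zero C a b" "a \<in> Ob C" "b \<in> Ob C"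
  shows "finsum (hom_group C a b) f {..<n} = f j"
proof -
  interpret G: abelian_group "hom_group C a b"
    using hom_abelian_group assms by blast
  have f: "f i \<in> Hom C a b" if "i < n" for i
    using assms that Zero_in_Hom by (cases "i = j") auto
  have "finsum (hom_group C a b) f {..<n}
      = finsum (hom_group C a b) (\<lambda>i. if j = i then f i else \<zero>\<^bsub>hom_group C a b\<^esub>) {..<n}"
    by (rule G.finsum_cong') (use assms f Zero_in_Hom in \<open>auto simp: hom_group_def Pi_def\<close>)
  also have "\<dots> = f j"
    by (rule G.finsum_singleton) (use assms f Zero_in_Hom in \<open>auto simp: hom_group_def Pi_def\<close>)
  finally show ?thesis .
qed

text \<open>This is \<open>direct_sum\<close> with the injections and projections exposed as
  parameters, so that later constructions can refer to them.\<close>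

definition biproduct :: "nat \<Rightarrow> (nat \<Rightarrow> 'a) \<Rightarrow> 'a \<Rightarrow> (nat \<Rightarrow> 'b) \<Rightarrow> (nat \<Rightarrow> 'b) \<Rightarrow> bool" where
  "biproduct n A M \<iota> \<pi> \<longleftrightarrow> M \<in> Ob C \<and> (\<forall>i<n. \<iota> i \<in> Hom C (A i) M \<and> \<pi> i \<in> Hom C M (A i)) \<and>
     (\<forall>i<n. \<forall>j<n. \<pi> i \<cdot> \<iota> j = (if i = j then Id C (A i) else Zero C (A j) (A i))) \<and>
     finsum (hom_group C M M) (\<lambda>i. \<iota> i \<cdot> \<pi> i) {..<n} = Id C M"

lemma direct_sum_iff_biproduct: "direct_sum C n A M \<longleftrightarrow> (\<exists>\<iota> \<pi>. biproduct n A M \<iota> \<pi>)"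
  unfolding direct_sum_def biproduct_def by blast

lemma biproductD:
  assumes "biproduct n A M \<iota> \<pi>" "i < n"
  shows "\<iota> i \<in> Hom C (A i) M" "\<pi> i \<in> Hom C M (A i)" "\<pi> i \<cdot> \<iota> i = Id C (A i)"
    "\<lbrakk>j < n; j \<noteq> i\<rbrakk> \<Longrightarrow> \<pi> i \<cdot> \<iota> j = Zero C (A j) (A i)" "A i \<in> Ob C"
  using assms in_HomD(4)[of "\<iota> i" "A i" M] by (auto simp: biproduct_def)

lemma biproduct_Ob: "biproduct n A M \<iota> \<pi> \<Longrightarrow> M \<in> Ob C"
  by (auto simp: biproduct_def)

text \<open>Direct sums are given by equations; this and the next two lemmas recover the universal
  properties. Here the identity of \<open>M\<close>, written as the sum of all injection-projection
  composites, is inserted before \<open>g\<close> and \<open>h\<close>.\<close>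

lemma biproduct_eqI_from:
  assumes bp: "biproduct n A M \<iota> \<pi>" and g: "g \<in> Hom C M x" "h \<in> Hom C M x"
    and eq: "\<And>i. i < n \<Longrightarrow> g \<cdot> \<iota> i = h \<cdot> \<iota> i"
  shows "g = h"
proof -
  have M: "M \<in> Ob C" "x \<in> Ob C" using in_HomD[OF g(1)] by auto
  have *: "k = finsum (hom_group C M x) (\<lambda>i. (k \<cdot> \<iota> i) \<cdot> \<pi> i) {..<n}" if k: "k \<in> Hom C M x" for k
  proof -
    have "k = k \<cdot> finsum (hom_group C M M) (\<lambda>i. \<iota> i \<cdot> \<pi> i) {..<n}"
      using bp comp_id_right[OF k] by (simp add: biproduct_def)
    also have "\<dots> = finsum (hom_group C M x) (\<lambda>i. k \<cdot> (\<iota> i \<cdot> \<pi> i)) {..<n}"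
      by (rule finsum_comp_left[OF _ M(1) k]) (use comp_in_Hom biproductD(1,2)[OF bp] in blast)
    also have "\<dots> = finsum (hom_group C M x) (\<lambda>i. (k \<cdot> \<iota> i) \<cdot> \<pi> i) {..<n}"
    proof (rule finsum_cong_hom[OF _ _ M])
      fix i assume i: "i < n"
      show "(k \<cdot> \<iota> i) \<cdot> \<pi> i \<in> Hom C M x"
        by (rule comp_in_Hom[OF biproductD(2)[OF bp i] comp_in_Hom[OF biproductD(1)[OF bp i] k]])
      show "k \<cdot> (\<iota> i \<cdot> \<pi> i) = (k \<cdot> \<iota> i) \<cdot> \<pi> i"
        by (rule comp_assoc[OF biproductD(2)[OF bp i] biproductD(1)[OF bp i] k])
    qed
    finally show ?thesis .
  qed
  have "finsum (hom_group C M x) (\<lambda>i. (g \<cdot> \<iota> i) \<cdot> \<pi> i) {..<n}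
      = finsum (hom_group C M x) (\<lambda>i. (h \<cdot> \<iota> i) \<cdot> \<pi> i) {..<n}"
  proof (rule finsum_cong_hom[OF _ _ M])
    fix i assume i: "i < n"
    show "(h \<cdot> \<iota> i) \<cdot> \<pi> i \<in> Hom C M x"
      by (rule comp_in_Hom[OF biproductD(2)[OF bp i] comp_in_Hom[OF biproductD(1)[OF bp i] g(2)]])
  qed (simp add: eq)
  then show ?thesis using *[OF g(1)] *[OF g(2)] by simp
qed

lemma biproduct_eqI_to:
  assumes bp: "biproduct n A M \<iota> \<pi>" and g: "g \<in> Hom C x M" "h \<in> Hom C x M"
    and eq: "\<And>i. i < n \<Longrightarrow> \<pi> i \<cdot> g = \<pi> i \<cdot> h"
  shows "g = h"
proof -
  have M: "x \<in> Ob C" "M \<in> Ob C" using in_HomD[OF g(1)] by auto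
  have *: "k = finsum (hom_group C x M) (\<lambda>i. \<iota> i \<cdot> (\<pi> i \<cdot> k)) {..<n}" if k: "k \<in> Hom C x M" for k
  proof -
    have "k = finsum (hom_group C M M) (\<lambda>i. \<iota> i \<cdot> \<pi> i) {..<n} \<cdot> k"
      using bp comp_id_left[OF k] by (simp add: biproduct_def)
    also have "\<dots> = finsum (hom_group C x M) (\<lambda>i. (\<iota> i \<cdot> \<pi> i) \<cdot> k) {..<n}"
      by (rule finsum_comp_right[OF _ M(2) k]) (use comp_in_Hom biproductD(1,2)[OF bp] in blast)
    also have "\<dots> = finsum (hom_group C x M) (\<lambda>i. \<iota> i \<cdot> (\<pi> i \<cdot> k)) {..<n}"
    proof (rule finsum_cong_hom[OF _ _ M])
      fix i assume i: "i < n"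
      show "\<iota> i \<cdot> (\<pi> i \<cdot> k) \<in> Hom C x M"
        by (rule comp_in_Hom[OF comp_in_Hom[OF k biproductD(2)[OF bp i]] biproductD(1)[OF bp i]])
      show "(\<iota> i \<cdot> \<pi> i) \<cdot> k = \<iota> i \<cdot> (\<pi> i \<cdot> k)"
        by (rule comp_assoc[symmetric, OF k biproductD(2)[OF bp i] biproductD(1)[OF bp i]])
    qed
    finally show ?thesis .
  qed
  have "finsum (hom_group C x M) (\<lambda>i. \<iota> i \<cdot> (\<pi> i \<cdot> g)) {..<n}
      = finsum (hom_group C x M) (\<lambda>i. \<iota> i \<cdot> (\<pi> i \<cdot> h)) {..<n}"
  proof (rule finsum_cong_hom[OF _ _ M])
    fix i assume i: "i < n"
    show "\<iota> i \<cdot> (\<pi> i \<cdot> h) \<in> Hom C x M"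
      by (rule comp_in_Hom[OF comp_in_Hom[OF g(2) biproductD(2)[OF bp i]] biproductD(1)[OF bp i]])
  qed (simp add: eq)
  then show ?thesis using *[OF g(1)] *[OF g(2)] by simp
qed

text \<open>The witness is the sum of the \<open>\<iota> i \<cdot> f i\<close>; composing with
  \<open>\<pi> j\<close> leaves the single term with index \<open>j\<close>.\<close>

lemma biproduct_lift:
  assumes bp: "biproduct n A M \<iota> \<pi>" and f: "\<And>i. i < n \<Longrightarrow> f i \<in> Hom C x (A i)" and x: "x \<in> Ob C"
  obtains h where "h \<in> Hom C x M" "\<And>i. i < n \<Longrightarrow> \<pi> i \<cdot> h = f i"
proof
  note M = biproduct_Ob[OF bp]
  let ?h = "finsum (hom_group C x M) (\<lambda>i. \<iota> i \<cdot> f i) {..<n}"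
  have s: "\<iota> i \<cdot> f i \<in> Hom C x M" if "i < n" for i
    by (rule comp_in_Hom[OF f[OF that] biproductD(1)[OF bp that]])
  show "?h \<in> Hom C x M" by (rule finsum_in_Hom[OF s x M])
  fix j assume j: "j < n"
  have a: "\<pi> j \<cdot> (\<iota> i \<cdot> f i) = (\<pi> j \<cdot> \<iota> i) \<cdot> f i" if "i < n" for i
    by (rule comp_assoc[OF f[OF that] biproductD(1)[OF bp that] biproductD(2)[OF bp j]])
  have jj: "\<pi> j \<cdot> (\<iota> j \<cdot> f j) = f j"
    using a[OF j] biproductD(3)[OF bp j] comp_id_left[OF f[OF j]] by simp
  have "\<pi> j \<cdot> ?h = finsum (hom_group C x (A j)) (\<lambda>i. \<pi> j \<cdot> (\<iota> i \<cdot> f i)) {..<n}"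
    by (rule finsum_comp_left[OF s x biproductD(2)[OF bp j]])
  also have "\<dots> = \<pi> j \<cdot> (\<iota> j \<cdot> f j)"
  proof (rule finsum_single[OF j _ _ x biproductD(5)[OF bp j]])
    show "\<pi> j \<cdot> (\<iota> j \<cdot> f j) \<in> Hom C x (A j)" using jj f[OF j] by simp
    fix i assume i: "i < n" "i \<noteq> j"
    show "\<pi> j \<cdot> (\<iota> i \<cdot> f i) = Zero C x (A j)"
      using a[OF i(1)] biproductD(4)[OF bp j i] comp_Zero_left[OF f[OF i(1)] biproductD(5)[OF bp j]] by simp
  qed
  finally show "\<pi> j \<cdot> ?h = f j" using jj by simp
qed

lemma semisimpleE:
  assumes "semisimple C M"
  obtains n A \<iota> \<pi> where "\<forall>i<n. simple C (A i)" "biproduct n A M \<iota> \<pi>"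
  using assms unfolding semisimple_def direct_sum_iff_biproduct by blast

lemma semisimpleI:
  assumes "\<forall>i<n. simple C (A i)" "biproduct n A M \<iota> \<pi>"
  shows "semisimple C M"
  using assms unfolding semisimple_def direct_sum_iff_biproduct by blast

lemma semisimple_Ob: "semisimple C M \<Longrightarrow> M \<in> Ob C"
  by (auto simp: semisimple_def direct_sum_def)

lemma zero_object_semisimple:
  assumes "zero_object C M"
  shows "semisimple C M"
proof (rule semisimpleI[of 0])
  show "biproduct 0 A M \<iota> \<pi>" for A \<iota> \<pi>
    using assms finsum_0_hom[of M M] by (simp add: biproduct_def zero_object_iff)
qed simp

lemma simple_semisimple:
  assumes "simple C M"
  shows "semisimple C M"
proof (rule semisimpleI[of 1 "\<lambda>_. M"])
  have M: "M \<in> Ob C" using assms by (simp add: simple_def)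
  then show "biproduct 1 (\<lambda>_. M) M (\<lambda>_. Id C M) (\<lambda>_. Id C M)"
    using id_in_Hom[OF M] comp_id_left[OF id_in_Hom[OF M]]
      finsum_single[of 0 1 "\<lambda>_. Id C M \<cdot> Id C M" M M]
    by (simp add: biproduct_def)
qed (use assms in simp)

text \<open>Transport of structure: the injections become \<open>f \<cdot> \<iota> i\<close> and the
  projections \<open>\<pi> i \<cdot> g\<close>. The relation \<open>g \<cdot> f = Id C M\<close>
  gives orthogonality, the other one gives the sum formula.\<close>

lemma semisimple_iso:
  assumes "semisimple C M" "f \<in> Hom C M N" "g \<in> Hom C N M" "g \<cdot> f = Id C M" "f \<cdot> g = Id C N"
  shows "semisimple C N"
proof -
  obtain n A \<iota> \<pi> where A: "\<forall>i<n. simple C (A i)" and bp: "biproduct n A M \<iota> \<pi>"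
    by (rule semisimpleE[OF assms(1)])
  have ob: "M \<in> Ob C" "N \<in> Ob C" using in_HomD[OF assms(2)] by auto
  note i1 = biproductD(1)[OF bp] and p1 = biproductD(2)[OF bp]
  have i2: "f \<cdot> \<iota> i \<in> Hom C (A i) N" and p2: "\<pi> i \<cdot> g \<in> Hom C N (A i)" if "i < n" for i
    using comp_in_Hom[OF i1[OF that] assms(2)] comp_in_Hom[OF assms(3) p1[OF that]] .
  have "\<pi> i \<cdot> g \<cdot> (f \<cdot> \<iota> j) = \<pi> i \<cdot> \<iota> j" if "i < n" "j < n" for i j
  proof -
    have "\<pi> i \<cdot> g \<cdot> (f \<cdot> \<iota> j) = \<pi> i \<cdot> (g \<cdot> (f \<cdot> \<iota> j))"
      by (rule comp_assoc[symmetric, OF i2[OF that(2)] assms(3) p1[OF that(1)]])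
    also have "g \<cdot> (f \<cdot> \<iota> j) = \<iota> j"
      using comp_assoc[OF i1[OF that(2)] assms(2,3)] comp_id_left[OF i1[OF that(2)]] assms(4) by simp
    finally show ?thesis .
  qed
  moreover have "finsum (hom_group C N N) (\<lambda>i. f \<cdot> \<iota> i \<cdot> (\<pi> i \<cdot> g)) {..<n} = Id C N"
  proof -
    have s: "\<iota> i \<cdot> \<pi> i \<in> Hom C M M" if "i < n" for i
      by (rule comp_in_Hom[OF p1[OF that] i1[OF that]])
    have t: "\<iota> i \<cdot> \<pi> i \<cdot> g \<in> Hom C N M" if "i < n" for i
      by (rule comp_in_Hom[OF assms(3) s[OF that]])
    have "finsum (hom_group C N N) (\<lambda>i. f \<cdot> \<iota> i \<cdot> (\<pi> i \<cdot> g)) {..<n}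
        = finsum (hom_group C N N) (\<lambda>i. f \<cdot> (\<iota> i \<cdot> \<pi> i \<cdot> g)) {..<n}"
    proof (rule finsum_cong_hom[OF _ _ ob(2) ob(2)])
      fix i assume i: "i < n"
      show "f \<cdot> (\<iota> i \<cdot> \<pi> i \<cdot> g) \<in> Hom C N N" by (rule comp_in_Hom[OF t[OF i] assms(2)])
      show "f \<cdot> \<iota> i \<cdot> (\<pi> i \<cdot> g) = f \<cdot> (\<iota> i \<cdot> \<pi> i \<cdot> g)"
        using comp_assoc[OF p2[OF i] i1[OF i] assms(2)] comp_assoc[OF assms(3) p1[OF i] i1[OF i]] by simp
    qed
    also have "\<dots> = f \<cdot> finsum (hom_group C N M) (\<lambda>i. \<iota> i \<cdot> \<pi> i \<cdot> g) {..<n}"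
      by (rule finsum_comp_left[symmetric, OF t ob(2) assms(2)])
    also have "\<dots> = f \<cdot> (finsum (hom_group C M M) (\<lambda>i. \<iota> i \<cdot> \<pi> i) {..<n} \<cdot> g)"
      by (subst finsum_comp_right[OF s ob(1) assms(3)]) simp_all
    also have "\<dots> = Id C N"
      using bp comp_id_left[OF assms(3)] assms(5) by (simp add: biproduct_def)
    finally show ?thesis .
  qed
  ultimately have "biproduct n A N (\<lambda>i. f \<cdot> \<iota> i) (\<lambda>i. \<pi> i \<cdot> g)"
    using i2 p2 ob bp unfolding biproduct_def by auto
  then show ?thesis by (rule semisimpleI[OF A])
qed

end

context abelian_category
begin

lemma ex_zero_object:
  obtains z where "z \<in> Ob C" "zero_object C z"
proof -
  obtain z where "direct_sum C 0 (\<lambda>_. undefined) z"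
    using direct_sums[of 0 "\<lambda>_. undefined"] by auto
  then show thesis
    using that[of z] finsum_0_hom[of z z] by (auto simp: direct_sum_def zero_object_iff)
qed

text \<open>The morphism with components \<open>f\<close> and \<open>q\<close> into the sum of
  \<open>P\<close> and \<open>S\<close> is epic: \<open>k\<close> is killed by \<open>f\<close> but
  not by \<open>q\<close>, so its image under the pair fills the summand \<open>S\<close>, and
  modulo \<open>S\<close> the pair is the epimorphism \<open>f\<close>. The last clause says that
  the kernel shrinks to a common part of both kernels.\<close>

lemma epic_extend_by_simple:
  assumes f: "f \<in> Hom C M P" "epic C f" "semisimple C P"
    and k: "k \<in> Hom C a M" "f \<cdot> k = Zero C a P"
    and q: "q \<in> Hom C M S" "simple C S" "q \<cdot> k \<noteq> Zero C a S"
  obtains P' f' where "semisimple C P'" "f' \<in> Hom C M P'" "epic C f'"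
    "\<And>x g. \<lbrakk>g \<in> Hom C x M; f' \<cdot> g = Zero C x P'\<rbrakk> \<Longrightarrow> f \<cdot> g = Zero C x P \<and> q \<cdot> g = Zero C x S"
proof -
  obtain n A \<iota> \<pi> where A: "\<forall>i<n. simple C (A i)" and bp: "biproduct n A P \<iota> \<pi>"
    by (rule semisimpleE[OF f(3)])
  \<comment> \<open>The new simple summand gets index \<open>n\<close>.\<close>
  define A' where "A' i = (if i < n then A i else S)" for i
  have A': "\<forall>i<Suc n. simple C (A' i)" using A q(2) by (auto simp: A'_def)
  then obtain P' \<iota>' \<pi>' where bp': "biproduct (Suc n) A' P' \<iota>' \<pi>'"
    using direct_sums[of "Suc n" A'] unfolding direct_sum_iff_biproduct simple_def by blast
  have ob: "M \<in> Ob C" "P \<in> Ob C" "P' \<in> Ob C" "S \<in> Ob C" "a \<in> Ob C"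
    using in_HomD[OF f(1)] in_HomD[OF q(1)] in_HomD[OF k(1)] biproduct_Ob[OF bp'] by auto
  note p1 = biproductD(2)[OF bp]
    and i2 = biproductD(1)[OF bp'] and p2 = biproductD(2)[OF bp']
  have "(if i < n then \<pi> i \<cdot> f else q) \<in> Hom C M (A' i)" if "i < Suc n" for i
    using comp_in_Hom[OF f(1) p1] q(1) that by (auto simp: A'_def)
  then obtain f' where f': "f' \<in> Hom C M P'"
    and f'i: "\<And>i. i < Suc n \<Longrightarrow> \<pi>' i \<cdot> f' = (if i < n then \<pi> i \<cdot> f else q)"
    using biproduct_lift[OF bp', of "\<lambda>i. if i < n then \<pi> i \<cdot> f else q" M] ob(1) by blast
  \<comment> \<open>The morphism \<open>e\<close> obtained here is the projection of
    \<open>P'\<close> onto \<open>P\<close> that forgets the summand \<open>S\<close>;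
    \<open>e'\<close> below is the inclusion of \<open>P\<close>.\<close>
  have "\<pi>' i \<in> Hom C P' (A i)" if "i < n" for i
    using p2[of i] that by (simp add: A'_def)
  then obtain e where e: "e \<in> Hom C P' P" and ei: "\<And>i. i < n \<Longrightarrow> \<pi> i \<cdot> e = \<pi>' i"
    using biproduct_lift[OF bp _ ob(3)] by blast
  have n: "A' n = S" "\<iota>' n \<in> Hom C S P'" "\<pi>' n \<in> Hom C P' S" "\<pi>' n \<cdot> f' = q"
    using i2[of n] p2[of n] f'i[of n] by (auto simp: A'_def)
  have "(if i < n then \<pi> i else Zero C P S) \<in> Hom C P (A' i)" if "i < Suc n" for i
    using p1 Zero_in_Hom[OF ob(2,4)] by (auto simp: A'_def)
  then obtain e' where e': "e' \<in> Hom C P P'"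
    and e'i: "\<And>i. i < Suc n \<Longrightarrow> \<pi>' i \<cdot> e' = (if i < n then \<pi> i else Zero C P S)"
    using biproduct_lift[OF bp', of "\<lambda>i. if i < n then \<pi> i else Zero C P S" P] ob(2) by blast
  have ef: "e \<cdot> f' = f"
  proof (rule biproduct_eqI_to[OF bp comp_in_Hom[OF f' e] f(1)])
    fix i assume i: "i < n"
    show "\<pi> i \<cdot> (e \<cdot> f') = \<pi> i \<cdot> f"
      using comp_assoc[OF f' e p1[OF i]] ei[OF i] f'i[of i] i by simp
  qed
  have f'k: "f' \<cdot> k = \<iota>' n \<cdot> (q \<cdot> k)"
  proof (rule biproduct_eqI_to[OF bp' comp_in_Hom[OF k(1) f'] comp_in_Hom[OF comp_in_Hom[OF k(1) q(1)] n(2)]])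
    fix i assume i: "i < Suc n"
    have l: "\<pi>' i \<cdot> (f' \<cdot> k) = (if i < n then \<pi> i \<cdot> f else q) \<cdot> k"
      using comp_assoc[OF k(1) f' p2[OF i]] f'i[OF i] by simp
    have r: "\<pi>' i \<cdot> (\<iota>' n \<cdot> (q \<cdot> k)) = (\<pi>' i \<cdot> \<iota>' n) \<cdot> (q \<cdot> k)"
      by (rule comp_assoc[OF comp_in_Hom[OF k(1) q(1)] n(2) p2[OF i]])
    show "\<pi>' i \<cdot> (f' \<cdot> k) = \<pi>' i \<cdot> (\<iota>' n \<cdot> (q \<cdot> k))"
    proof (cases "i < n")
      case True
      have Ai: "A i \<in> Ob C" by (rule biproductD(5)[OF bp True])
      have "(\<pi> i \<cdot> f) \<cdot> k = Zero C a (A i)"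
        using comp_assoc[OF k(1) f(1) p1[OF True]] k(2) comp_Zero_right[OF p1[OF True] ob(5)] by simp
      moreover have "\<pi>' i \<cdot> \<iota>' n = Zero C S (A i)"
        using biproductD(4)[OF bp' i, of n] True n(1) by (simp add: A'_def)
      ultimately show ?thesis
        using l r True comp_Zero_left[OF comp_in_Hom[OF k(1) q(1)] Ai] by simp
    next
      case False
      then have "i = n" using i by simp
      then show ?thesis
        using l r biproductD(3)[OF bp' i] n(1) comp_id_left[OF comp_in_Hom[OF k(1) q(1)]] by simp
    qed
  qed
  have qk: "epic C (q \<cdot> k)"
    by (rule to_simple_epic[OF q(2) comp_in_Hom[OF k(1) q(1)] q(3)])
  have epi: "epic C f'"
  proof (rule epic_ZeroI[OF f'])
    fix x g assume g: "g \<in> Hom C P' x" "g \<cdot> f' = Zero C M x"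
    have x: "x \<in> Ob C" using in_HomD[OF g(1)] by auto
    have gn: "g \<cdot> \<iota>' n \<in> Hom C S x" by (rule comp_in_Hom[OF n(2) g(1)])
    have "(g \<cdot> \<iota>' n) \<cdot> (q \<cdot> k) = g \<cdot> (f' \<cdot> k)"
      using comp_assoc[OF comp_in_Hom[OF k(1) q(1)] n(2) g(1)] f'k by simp
    also have "\<dots> = Zero C a x"
      using comp_assoc[OF k(1) f' g(1)] g(2) comp_Zero_left[OF k(1) x] by simp
    finally have gn0: "g \<cdot> \<iota>' n = Zero C S x"
      by (rule epic_ZeroD[OF qk comp_in_Hom[OF k(1) q(1)] gn])
    \<comment> \<open>Since \<open>g\<close> vanishes on the summand \<open>S\<close>, it is
      recovered from its restriction to \<open>P\<close>; that restriction kills the epimorphism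
      \<open>f\<close>, so it is zero.\<close>
    let ?g = "g \<cdot> e'"
    have gH: "?g \<in> Hom C P x" by (rule comp_in_Hom[OF e' g(1)])
    have ge: "?g \<cdot> e = g"
    proof (rule biproduct_eqI_from[OF bp' comp_in_Hom[OF e gH] g(1)])
      fix i assume i: "i < Suc n"
      have 1: "(?g \<cdot> e) \<cdot> \<iota>' i = g \<cdot> (e' \<cdot> (e \<cdot> \<iota>' i))"
        using comp_assoc[OF i2[OF i] e gH] comp_assoc[OF comp_in_Hom[OF i2[OF i] e] e' g(1)] by simp
      show "(?g \<cdot> e) \<cdot> \<iota>' i = g \<cdot> \<iota>' i"
      proof (cases "i < n")
        case True
        have "e' \<cdot> (e \<cdot> \<iota>' i) = \<iota>' i"
        proof (rule biproduct_eqI_to[OF bp' comp_in_Hom[OF comp_in_Hom[OF i2[OF i] e] e'] i2[OF i]])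
          fix j assume j: "j < Suc n"
          have 2: "\<pi>' j \<cdot> (e' \<cdot> (e \<cdot> \<iota>' i)) = (if j < n then \<pi> j else Zero C P S) \<cdot> (e \<cdot> \<iota>' i)"
            using comp_assoc[OF comp_in_Hom[OF i2[OF i] e] e' p2[OF j]] e'i[OF j] by simp
          show "\<pi>' j \<cdot> (e' \<cdot> (e \<cdot> \<iota>' i)) = \<pi>' j \<cdot> \<iota>' i"
          proof (cases "j < n")
            case True
            then show ?thesis using 2 comp_assoc[OF i2[OF i] e p1[OF True]] ei[OF True] by simp
          next
            case False
            then have "j = n" using j by simp
            moreover have "\<pi>' n \<cdot> \<iota>' i = Zero C (A' i) S"
              using biproductD(4)[OF bp' _ i, of n] True n(1) by simp
            ultimately show ?thesis
              using 2 comp_Zero_left[OF comp_in_Hom[OF i2[OF i] e] ob(4)] by simp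
          qed
        qed
        then show ?thesis using 1 by simp
      next
        case False
        then have [simp]: "i = n" using i by simp
        have "e \<cdot> \<iota>' n = Zero C S P"
        proof (rule biproduct_eqI_to[OF bp comp_in_Hom[OF n(2) e] Zero_in_Hom[OF ob(4,2)]])
          fix j assume j: "j < n"
          have "\<pi> j \<cdot> (e \<cdot> \<iota>' n) = \<pi>' j \<cdot> \<iota>' n"
            using comp_assoc[OF n(2) e p1[OF j]] ei[OF j] by simp
          also have "\<dots> = Zero C S (A j)"
            using biproductD(4)[OF bp', of j n] j n(1) by (simp add: A'_def)
          also have "\<dots> = \<pi> j \<cdot> Zero C S P"
            by (rule comp_Zero_right[symmetric, OF p1[OF j] ob(4)])
          finally show "\<pi> j \<cdot> (e \<cdot> \<iota>' n) = \<pi> j \<cdot> Zero C S P" .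
        qed
        then show ?thesis
          using 1 gn0 comp_Zero_right[OF e' ob(4)] comp_Zero_right[OF g(1) ob(4)] by simp
      qed
    qed
    have "?g \<cdot> f = Zero C M x"
      using comp_assoc[OF f' e gH] ef ge g(2) by simp
    then have "?g = Zero C P x" by (rule epic_ZeroD[OF f(2,1) gH])
    then show "g = Zero C P' x" using ge comp_Zero_left[OF e x] by simp
  qed
  show thesis
  proof (rule that[OF semisimpleI[OF A' bp'] f' epi])
    fix x g assume g: "g \<in> Hom C x M" "f' \<cdot> g = Zero C x P'"
    have x: "x \<in> Ob C" using in_HomD[OF g(1)] by auto
    show "f \<cdot> g = Zero C x P \<and> q \<cdot> g = Zero C x S"
      using comp_assoc[OF g(1) f' e] comp_assoc[OF g(1) f' n(3)] ef n(4) g(2)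
        comp_Zero_right[OF e x] comp_Zero_right[OF n(3) x] by simp
  qed
qed

end

section \<open>The descending chain condition\<close>

context abelian_category
begin

text \<open>As \<open>sub_less\<close> is the strict part of a preorder, equivalent monomorphisms
  are never strictly related. Well-foundedness on representatives is therefore the descending chain
  condition on genuine subobjects.\<close>

definition artinian :: "'a \<Rightarrow> bool" where
  "artinian M \<longleftrightarrow> wf {(s, t). subobject C M s \<and> subobject C M t \<and> sub_less C s t}"

lemma artinian_minimal:
  assumes "artinian M" "subobject C M s" "P s"
  obtains t where "subobject C M t" "P t" "\<And>s. \<lbrakk>subobject C M s; P s\<rbrakk> \<Longrightarrow> \<not> sub_less C s t"
proof -
  obtain t where "t \<in> {s. subobject C M s \<and> P s}"
    "\<And>y. (y, t) \<in> {(s, t). subobject C M s \<and> subobject C M t \<and> sub_less C s t} \<Longrightarrow>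
      y \<notin> {s. subobject C M s \<and> P s}"
    by (rule wfE_min[OF assms(1)[unfolded artinian_def], of s "{s. subobject C M s \<and> P s}"])
      (use assms in auto)
  then show thesis using that[of t] by blast
qed

text \<open>Composition with the isomorphism \<open>g\<close> preserves and reflects inclusion, so
  the strict order for \<open>N\<close> lies in an inverse image of the one for
  \<open>M\<close>.\<close>

lemma artinian_iso:
  assumes "artinian M" "f \<in> Hom C M N" "g \<in> Hom C N M" "g \<cdot> f = Id C M" "f \<cdot> g = Id C N"
  shows "artinian N"
proof -
  let ?r = "\<lambda>M. {(s, t). subobject C M s \<and> subobject C M t \<and> sub_less C s t}"
  have g: "monic C g"
    by (rule iso_arr_monic[OF iso_arrI[OF assms(3,2,5,4)]])
  have sub: "subobject C M (g \<cdot> s)" if "subobject C N s" for s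
    using subobjectI[OF monic_comp[OF g assms(3) subobject_monic subobject_in_Hom] comp_in_Hom[OF subobject_in_Hom assms(3)]] that
    by blast
  have le: "sub_le C (g \<cdot> s) (g \<cdot> t) \<longleftrightarrow> sub_le C s t" if s: "subobject C N s" and t: "subobject C N t" for s t
  proof
    note sH = subobject_in_Hom[OF s] and tH = subobject_in_Hom[OF t]
    show "sub_le C s t" if *: "sub_le C (g \<cdot> s) (g \<cdot> t)"
    proof -
      obtain u where u: "u \<in> Hom C (Dom C s) (Dom C t)" "g \<cdot> t \<cdot> u = g \<cdot> s"
        by (rule sub_leE[OF * comp_in_Hom[OF sH assms(3)] comp_in_Hom[OF tH assms(3)]])
      have "g \<cdot> (t \<cdot> u) = g \<cdot> s" using comp_assoc[OF u(1) tH assms(3)] u(2) by simp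
      then have "t \<cdot> u = s" by (rule monicD[OF g assms(3) comp_in_Hom[OF u(1) tH] sH])
      then show ?thesis by (rule sub_leI[OF sH tH u(1)])
    qed
    show "sub_le C (g \<cdot> s) (g \<cdot> t)" if *: "sub_le C s t"
    proof -
      obtain u where u: "u \<in> Hom C (Dom C s) (Dom C t)" "t \<cdot> u = s"
        by (rule sub_leE[OF * sH tH])
      have "g \<cdot> t \<cdot> u = g \<cdot> s" using comp_assoc[OF u(1) tH assms(3)] u(2) by simp
      then show ?thesis
        by (rule sub_leI[OF comp_in_Hom[OF sH assms(3)] comp_in_Hom[OF tH assms(3)] u(1)])
    qed
  qed
  have "wf (inv_image (?r M) (\<lambda>s. g \<cdot> s))"
    using assms(1) unfolding artinian_def by (rule wf_inv_image)
  then show ?thesis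
    unfolding artinian_def
    by (rule wf_subset) (use sub le in \<open>auto simp: inv_image_def sub_less_def\<close>)
qed

text \<open>The preimage of \<open>s\<close> along \<open>k\<close> is the kernel of
  \<open>k\<close> followed by the cokernel of \<open>s\<close>. It is characterised against all
  morphisms \<open>x\<close>, monic or not, because \<open>sub_le\<close> just expresses
  factorisation.\<close>

lemma ex_pullback:
  assumes s: "subobject C M s" and k: "k \<in> Hom C N M"
  shows "\<exists>j. subobject C N j \<and> (\<forall>y. \<forall>x \<in> Hom C y N. sub_le C x j \<longleftrightarrow> sub_le C (k \<cdot> x) s)"
proof -
  note sH = subobject_in_Hom[OF s]
  obtain d c where d: "is_cokernel C s d" "d \<in> Hom C M c" by (rule ex_cokernel[OF sH])
  note dk = comp_in_Hom[OF k d(2)]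
  obtain j e where j: "is_kernel C (d \<cdot> k) j" "j \<in> Hom C e N" by (rule ex_kernel[OF dk])
  have "sub_le C x j \<longleftrightarrow> sub_le C (k \<cdot> x) s" if x: "x \<in> Hom C y N" for x y
  proof
    note kx = comp_in_Hom[OF x k]
    have a: "d \<cdot> (k \<cdot> x) = (d \<cdot> k) \<cdot> x" by (rule comp_assoc[OF x k d(2)])
    have y: "y \<in> Ob C" "c \<in> Ob C" using in_HomD[OF x] in_HomD[OF d(2)] by auto
    show "sub_le C (k \<cdot> x) s" if *: "sub_le C x j"
    proof -
      obtain u where u: "u \<in> Hom C y e" "j \<cdot> u = x" by (rule sub_leE[OF * x j(2)])
      have "d \<cdot> (k \<cdot> x) = Zero C y c"
        using a comp_assoc[OF u(1) j(2) dk] u(2) kernel_comp[OF j(1) dk j(2)] comp_Zero_left[OF u(1) y(2)] by simp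
      then obtain v where "v \<in> Hom C y (Dom C s)" "s \<cdot> v = k \<cdot> x"
        by (rule kernel_factor[OF monic_kernel_of_cokernel[OF subobject_monic[OF s] sH d] d(2) sH kx])
      then show ?thesis by (rule sub_leI[OF kx sH])
    qed
    show "sub_le C x j" if *: "sub_le C (k \<cdot> x) s"
    proof -
      obtain u where u: "u \<in> Hom C y (Dom C s)" "s \<cdot> u = k \<cdot> x" by (rule sub_leE[OF * kx sH])
      have "(d \<cdot> k) \<cdot> x = Zero C y c"
        using a comp_assoc[OF u(1) sH d(2)] u(2) cokernel_comp[OF d(1) sH d(2)] comp_Zero_left[OF u(1) y(2)] by simp
      then obtain v where "v \<in> Hom C y e" "j \<cdot> v = x"
        by (rule kernel_factor[OF j(1) dk j(2) x])
      then show ?thesis by (rule sub_leI[OF x j(2)])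
    qed
  qed
  then show ?thesis using subobjectI[OF kernel_monic[OF j(1)] j(2)] by blast
qed

text \<open>A strict inclusion of subobjects of \<open>M\<close> either enlarges the image in
  \<open>S\<close>, which can happen only once, or keeps the image and strictly enlarges the
  intersection with the kernel \<open>N\<close>. A lexicographic order on these two data is
  well-founded.\<close>

lemma artinian_of_kernel_to_simple:
  assumes p: "p \<in> Hom C M S" "simple C S" and k: "is_kernel C p k" "k \<in> Hom C N M"
    and N: "artinian N"
  shows "artinian M"
proof -
  let ?r = "\<lambda>M. {(s, t). subobject C M s \<and> subobject C M t \<and> sub_less C s t}"
  define pb where "pb s = (SOME j. subobject C N j \<and>
    (\<forall>y. \<forall>x \<in> Hom C y N. sub_le C x j \<longleftrightarrow> sub_le C (k \<cdot> x) s))" for s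
  have pb: "subobject C N (pb s)" "\<And>x y. x \<in> Hom C y N \<Longrightarrow> sub_le C x (pb s) \<longleftrightarrow> sub_le C (k \<cdot> x) s"
    if "subobject C M s" for s
    using someI_ex[OF ex_pullback[OF that k(2)]] unfolding pb_def[symmetric] by blast+
  \<comment> \<open>As \<open>S\<close> is simple, the image of \<open>s\<close> under
    \<open>p\<close> is zero or all of \<open>S\<close>; \<open>z s\<close> is the length of this
    image.\<close>
  define z where "z s = (if p \<cdot> s = Zero C (Dom C s) S then 0 else 1 :: nat)" for s
  have refl: "sub_le C x x" if "x \<in> Hom C a b" for x a b
    by (rule sub_leI[OF that that id_in_Hom comp_id_right[OF that]]) (use in_HomD[OF that] in auto)
  have S: "S \<in> Ob C" using p(2) by (simp add: simple_def)
  \<comment> \<open>This is the modular law: \<open>s\<close> below \<open>t\<close> with the same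
    image in \<open>S\<close> and the same intersection with \<open>N\<close> forces
    \<open>t\<close> below \<open>s\<close>.\<close>
  have main: "z s < z t \<or> z s = z t \<and> sub_less C (pb s) (pb t)"
    if s: "subobject C M s" and t: "subobject C M t" and less: "sub_less C s t" for s t
  proof (rule ccontr)
    assume neg: "\<not> (z s < z t \<or> z s = z t \<and> sub_less C (pb s) (pb t))"
    define a b where "a = Dom C s" and "b = Dom C t"
    have sH: "s \<in> Hom C a M" and tH: "t \<in> Hom C b M"
      using subobject_in_Hom s t by (auto simp: a_def b_def)
    have "sub_le C s t" using less by (simp add: sub_less_def)
    then obtain u where u: "u \<in> Hom C a b" "t \<cdot> u = s" by (rule sub_leE[OF _ sH tH])
    note ps = comp_in_Hom[OF sH p(1)] and pt = comp_in_Hom[OF tH p(1)]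
    have psu: "p \<cdot> s = (p \<cdot> t) \<cdot> u" using comp_assoc[OF u(1) tH p(1)] u(2) by simp
    have "z s \<le> z t"
      using psu comp_Zero_left[OF u(1) S] by (simp add: z_def a_def b_def)
    then have zz: "z s = z t" using neg by simp
    have pbs: "pb s \<in> Hom C (Dom C (pb s)) N" and pbt: "pb t \<in> Hom C (Dom C (pb t)) N"
      using pb(1) s t subobject_in_Hom by auto
    have "sub_le C (k \<cdot> pb s) s" using pb(2)[OF s pbs] refl[OF pbs] by simp
    then have "sub_le C (k \<cdot> pb s) t"
      by (rule sub_le_trans[OF _ \<open>sub_le C s t\<close> comp_in_Hom[OF pbs k(2)] sH tH])
    then have "sub_le C (pb s) (pb t)" using pb(2)[OF t pbs] by simp
    then have pts: "sub_le C (pb t) (pb s)" using neg zz by (simp add: sub_less_def)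
    \<comment> \<open>\<open>s\<close> and \<open>t\<close> have the same intersection with \<open>k\<close>.\<close>
    have meet: "sub_le C (k \<cdot> x) s" if x: "x \<in> Hom C y N" "sub_le C (k \<cdot> x) t" for x y
      using pb(2)[OF t x(1)] pb(2)[OF s x(1)] sub_le_trans[OF _ pts x(1) pbt pbs] x(2) by blast
    have "sub_le C t s"
    proof (cases "p \<cdot> t = Zero C b S")
      case True
      obtain x where x: "x \<in> Hom C b N" "k \<cdot> x = t"
        by (rule kernel_factor[OF k(1) p(1) k(2) tH True])
      then show ?thesis using meet[OF x(1)] refl[OF tH] by simp
    next
      case False
      then have nz: "p \<cdot> s \<noteq> Zero C a S" using zz by (auto simp: z_def a_def b_def split: if_splits)
      have epi: "epic C (p \<cdot> s)" "epic C (p \<cdot> t)"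
        using to_simple_epic[OF p(2) ps nz] to_simple_epic[OF p(2) pt False] .
      obtain l e where l: "is_kernel C (p \<cdot> t) l" "l \<in> Hom C e b" by (rule ex_kernel[OF pt])
      note tl = comp_in_Hom[OF l(2) tH]
      have "p \<cdot> (t \<cdot> l) = Zero C e S"
        using comp_assoc[OF l(2) tH p(1)] kernel_comp[OF l(1) pt l(2)] by simp
      then obtain x where x: "x \<in> Hom C e N" "k \<cdot> x = t \<cdot> l"
        by (rule kernel_factor[OF k(1) p(1) k(2) tl])
      have "sub_le C (t \<cdot> l) t" by (rule sub_leI[OF tl tH l(2)]) simp
      then have "sub_le C (t \<cdot> l) s" using meet[OF x(1)] x(2) by simp
      then obtain w where w: "w \<in> Hom C e a" "s \<cdot> w = t \<cdot> l" by (rule sub_leE[OF _ tl sH])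
      have "t \<cdot> l = t \<cdot> (u \<cdot> w)" using comp_assoc[OF w(1) u(1) tH] u(2) w(2) by simp
      then have luw: "l = u \<cdot> w"
        by (rule monicD[OF subobject_monic[OF t] tH l(2) comp_in_Hom[OF w(1) u(1)]])
      \<comment> \<open>Something that kills \<open>u\<close> kills the kernel \<open>l\<close> of
        \<open>p \<cdot> t\<close>, because \<open>l\<close> factors through \<open>u\<close>; so it
        factors through \<open>p \<cdot> t\<close>. Its factor then kills the epimorphism
        \<open>p \<cdot> s\<close>.\<close>
      have "epic C u"
      proof (rule epic_ZeroI[OF u(1)])
        fix y g assume g: "g \<in> Hom C b y" "g \<cdot> u = Zero C a y"
        have y: "y \<in> Ob C" using in_HomD[OF g(1)] by auto
        have "g \<cdot> l = Zero C e y"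
          using luw comp_assoc[OF w(1) u(1) g(1)] g(2) comp_Zero_left[OF w(1) y] by simp
        then obtain h where h: "h \<in> Hom C S y" "h \<cdot> (p \<cdot> t) = g"
          by (rule cokernel_factor[OF epic_cokernel_of_kernel[OF epi(2) pt l] l(2) pt g(1)])
        have "h \<cdot> (p \<cdot> s) = Zero C a y"
          using psu comp_assoc[OF u(1) pt h(1)] h(2) g(2) by simp
        then have "h = Zero C S y" by (rule epic_ZeroD[OF epi(1) ps h(1)])
        then show "g = Zero C b y" using h(2) comp_Zero_left[OF pt y] by simp
      qed
      moreover have "monic C u"
        by (rule monic_of_comp[OF _ tH u(1)]) (use u(2) subobject_monic[OF s] in simp)
      ultimately obtain v where v: "v \<in> Hom C b a" "u \<cdot> v = Id C b"
        using iso_arrE[OF monic_epic_iso u(1)] u(1) by blast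
      have "s \<cdot> v = t" using comp_assoc[OF v(1) u(1) tH] u(2) v(2) comp_id_right[OF tH] by simp
      then show ?thesis by (rule sub_leI[OF tH sH v(1)])
    qed
    then show False using less by (simp add: sub_less_def)
  qed
  have "wf (inv_image (less_than <*lex*> ?r N) (\<lambda>s. (z s, pb s)))"
    using N unfolding artinian_def by (intro wf_inv_image wf_lex_prod wf_less_than)
  then show ?thesis
    unfolding artinian_def
    by (rule wf_subset) (use main pb(1) in \<open>auto simp: inv_image_def\<close>)
qed

text \<open>A semisimple quotient is presented by its components \<open>p i\<close>, because a joint
  kernel restricts well: on the kernel of \<open>p n\<close> the remaining morphisms still have
  joint kernel \<open>N\<close>, and one simple factor has been peeled off.\<close>

lemma artinian_of_joint_kernel:
  fixes n :: nat
  assumes "\<And>i. i < n \<Longrightarrow> simple C (A i)" "\<And>i. i < n \<Longrightarrow> p i \<in> Hom C M (A i)"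
    and "k \<in> Hom C N M" "monic C k" "\<And>i. i < n \<Longrightarrow> p i \<cdot> k = Zero C N (A i)"
    and "\<And>x g. \<lbrakk>g \<in> Hom C x M; \<And>i. i < n \<Longrightarrow> p i \<cdot> g = Zero C x (A i)\<rbrakk> \<Longrightarrow> \<exists>u \<in> Hom C x N. k \<cdot> u = g"
    and "artinian N"
  shows "artinian M"
  using assms
proof (induction n arbitrary: M k p)
  case 0
  have M: "M \<in> Ob C" "N \<in> Ob C" using in_HomD[OF 0(3)] by auto
  \<comment> \<open>With no conditions left, even the identity of \<open>M\<close> factors through
    \<open>k\<close>, so \<open>k\<close> is an isomorphism.\<close>
  obtain u where u: "u \<in> Hom C M N" "k \<cdot> u = Id C M"
    using 0(6)[OF id_in_Hom[OF M(1)]] by auto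
  have "k \<cdot> (u \<cdot> k) = k \<cdot> Id C N"
    using comp_assoc[OF 0(3) u(1) 0(3)] u(2) comp_id_left[OF 0(3)] comp_id_right[OF 0(3)] by simp
  then have "u \<cdot> k = Id C N"
    by (rule monicD[OF 0(4,3) comp_in_Hom[OF 0(3) u(1)] id_in_Hom[OF M(2)]])
  then show ?case using artinian_iso[OF 0(7,3) u(1)] u(2) by simp
next
  case (Suc n)
  note A = Suc.prems(1) and p = Suc.prems(2) and k = Suc.prems(3-6)
  have Ob: "A i \<in> Ob C" if "i < Suc n" for i using A[OF that] by (simp add: simple_def)
  obtain l e where l: "is_kernel C (p n) l" "l \<in> Hom C e M" by (rule ex_kernel[OF p[of n]]) auto
  have pk: "p n \<cdot> k = Zero C N (A n)" using k(3) by simp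
  obtain k' where k': "k' \<in> Hom C N e" "l \<cdot> k' = k"
    by (rule kernel_factor[OF l(1) p l(2) k(1) pk]) auto
  have "artinian e"
  proof (rule Suc.IH[of "\<lambda>i. p i \<cdot> l" e k'])
    show "monic C k'" by (rule monic_of_comp[OF _ l(2) k'(1)]) (use k' k in simp)
    show "p i \<cdot> l \<in> Hom C e (A i)" if "i < n" for i
      by (rule comp_in_Hom[OF l(2) p]) (use that in simp)
    show "p i \<cdot> l \<cdot> k' = Zero C N (A i)" if "i < n" for i
      using comp_assoc[OF k'(1) l(2) p[of i]] k'(2) k(3)[of i] that by simp
    fix x g assume g: "g \<in> Hom C x e" "\<And>i. i < n \<Longrightarrow> p i \<cdot> l \<cdot> g = Zero C x (A i)"
    have "p i \<cdot> (l \<cdot> g) = Zero C x (A i)" if "i < Suc n" for i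
    proof (cases "i = n")
      case True
      then show ?thesis
        using comp_assoc[OF g(1) l(2) p[OF that]] kernel_comp[OF l(1) p[of n] l(2)]
          comp_Zero_left[OF g(1) Ob[OF that]] by simp
    next
      case False
      then show ?thesis using comp_assoc[OF g(1) l(2) p[OF that]] g(2)[of i] that by simp
    qed
    then obtain u where u: "u \<in> Hom C x N" "k \<cdot> u = l \<cdot> g"
      using k(4)[OF comp_in_Hom[OF g(1) l(2)]] by blast
    have "l \<cdot> (k' \<cdot> u) = l \<cdot> g" using comp_assoc[OF u(1) k'(1) l(2)] k'(2) u(2) by simp
    then have "k' \<cdot> u = g"
      by (rule monicD[OF kernel_monic[OF l(1)] l(2) comp_in_Hom[OF u(1) k'(1)] g(1)])
    then show "\<exists>u \<in> Hom C x N. k' \<cdot> u = g" using u(1) by blast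
  qed (use A k' Suc.prems(7) in auto)
  then show ?case
    using artinian_of_kernel_to_simple[OF p A l] by simp
qed

lemma quotient_short_exact:
  assumes "quotient C t s Q" "subobject C M s" "subobject C M t"
  obtains u q where "u \<in> Hom C (Dom C s) (Dom C t)" "t \<cdot> u = s" "q \<in> Hom C (Dom C t) Q"
    "short_exact C u q"
proof -
  obtain u q where u: "u \<in> Hom C (Dom C s) (Dom C t)" "t \<cdot> u = s" and q: "is_cokernel C u q" "Cod C q = Q"
    using assms(1) unfolding quotient_def by blast
  have "monic C u"
    by (rule monic_of_comp[OF _ subobject_in_Hom[OF assms(3)] u(1)])
      (use u(2) subobject_monic[OF assms(2)] in simp)
  moreover have "q \<in> Hom C (Dom C t) Q" using cokernel_in_Hom[OF q(1) u(1)] q(2) by simp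
  ultimately show thesis
    using that u q monic_kernel_of_cokernel[OF _ u(1) q(1)] by (simp add: short_exact_def)
qed

lemma artinian_extension:
  assumes "k \<in> Hom C N M" "q \<in> Hom C M Q" "is_kernel C q k" "semisimple C Q" "artinian N"
  shows "artinian M"
proof -
  obtain n A \<iota> \<pi> where A: "\<forall>i<n. simple C (A i)" and bp: "biproduct n A Q \<iota> \<pi>"
    by (rule semisimpleE[OF assms(4)])
  note p1 = biproductD(2)[OF bp]
  have ob: "N \<in> Ob C" "Q \<in> Ob C" using in_HomD[OF assms(1)] in_HomD[OF assms(2)] by auto
  show ?thesis
  proof (rule artinian_of_joint_kernel[where n = n and A = A and p = "\<lambda>i. \<pi> i \<cdot> q" and k = k])
    show "\<pi> i \<cdot> q \<in> Hom C M (A i)" if "i < n" for i by (rule comp_in_Hom[OF assms(2) p1[OF that]])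
    show "\<pi> i \<cdot> q \<cdot> k = Zero C N (A i)" if "i < n" for i
      using comp_assoc[OF assms(1,2) p1[OF that]] kernel_comp[OF assms(3,2,1)]
        comp_Zero_right[OF p1[OF that] ob(1)] by simp
    fix x g assume g: "g \<in> Hom C x M" "\<And>i. i < n \<Longrightarrow> \<pi> i \<cdot> q \<cdot> g = Zero C x (A i)"
    have x: "x \<in> Ob C" using in_HomD[OF g(1)] by auto
    have "q \<cdot> g = Zero C x Q"
    proof (rule biproduct_eqI_to[OF bp comp_in_Hom[OF g(1) assms(2)] Zero_in_Hom[OF x ob(2)]])
      fix i assume i: "i < n"
      show "\<pi> i \<cdot> (q \<cdot> g) = \<pi> i \<cdot> Zero C x Q"
        using comp_assoc[OF g(1) assms(2) p1[OF i]] g(2)[OF i] comp_Zero_right[OF p1[OF i] x] by simp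
    qed
    then show "\<exists>u \<in> Hom C x N. k \<cdot> u = g"
      using kernel_factor[OF assms(3,2,1) g(1)] by blast
  qed (use A assms kernel_monic in auto)
qed

lemma artinian_zero_object:
  assumes "zero_object C Z"
  shows "artinian Z"
proof -
  have "\<not> sub_less C s t" if s: "subobject C Z s" and t: "subobject C Z t" for s t
  proof -
    note tH = subobject_in_Hom[OF t]
    have "monic C (Zero C (Dom C t) Z)"
      using subobject_monic[OF t] zero_object_to[OF assms tH] by simp
    then have "zero_object C (Dom C t)"
      using monic_Zero_imp_zero_object in_HomD[OF tH] by blast
    then show ?thesis
      using zero_object_sub_le[OF _ tH subobject_in_Hom[OF s]] by (simp add: sub_less_def)
  qed
  then show ?thesis unfolding artinian_def wf_def by blast
qed

text \<open>The chain condition climbs the series from the zero object, one semisimple extension at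
  a time. This brings finiteness into the target, where a Loewy length provides such a
  series.\<close>

lemma semisimple_series_artinian:
  assumes "semisimple_series C M n m"
  shows "artinian M"
proof -
  have m: "\<And>i. i \<le> n \<Longrightarrow> subobject C M (m i)" and 0: "zero_object C (Dom C (m 0))" and "iso_arr C (m n)"
    and Q: "\<And>i. i < n \<Longrightarrow> \<exists>Q. quotient C (m (Suc i)) (m i) Q \<and> semisimple C Q"
    using assms by (auto simp: semisimple_series_def series_def)
  have "artinian (Dom C (m i))" if "i \<le> n" for i
    using that
  proof (induction i)
    case 0
    show ?case by (rule artinian_zero_object[OF \<open>zero_object C (Dom C (m 0))\<close>])
  next
    case (Suc i)
    obtain Q where Q: "quotient C (m (Suc i)) (m i) Q" "semisimple C Q" using Q[of i] Suc.prems by auto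
    obtain u q where "u \<in> Hom C (Dom C (m i)) (Dom C (m (Suc i)))"
      "q \<in> Hom C (Dom C (m (Suc i))) Q" "short_exact C u q"
      by (rule quotient_short_exact[OF Q(1) m m]) (use Suc.prems in auto)
    then show ?case
      using artinian_extension Q(2) Suc unfolding short_exact_def by auto
  qed
  moreover obtain g where "g \<in> Hom C M (Dom C (m n))" "g \<cdot> m n = Id C (Dom C (m n))" "m n \<cdot> g = Id C M"
    using iso_arrE[OF \<open>iso_arr C (m n)\<close> subobject_in_Hom[OF m]] by blast
  ultimately show ?thesis
    using artinian_iso[OF _ subobject_in_Hom[OF m]] by blast
qed

lemma finite_length_artinian:
  assumes "finite_length C M"
  shows "artinian M"
  using assms semisimple_series_artinian simple_semisimple
  unfolding finite_length_def semisimple_series_def by blast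

text \<open>This turns an abstract isomorphism into an inclusion. The isomorphism followed by the
  inclusion \<open>u\<close> of \<open>s\<close> in \<open>t\<close> is a monic endomorphism
  \<open>w\<close> of the domain of \<open>t\<close>; if \<open>w\<close> is invertible on the
  right, so is \<open>u\<close>. The chain is formed by the composites of \<open>t\<close> with
  powers of \<open>w\<close>, so the condition on \<open>M\<close> itself applies.\<close>

lemma artinian_isomorphic_sub_le:
  assumes M: "artinian M" and s: "subobject C M s" and t: "subobject C M t" and le: "sub_le C s t"
    and iso: "isomorphic C (Dom C t) (Dom C s)"
  shows "sub_le C t s"
proof -
  define a b where "a = Dom C s" and "b = Dom C t"
  have sH: "s \<in> Hom C a M" and tH: "t \<in> Hom C b M"
    using subobject_in_Hom s t by (auto simp: a_def b_def)
  obtain u where u: "u \<in> Hom C a b" "t \<cdot> u = s" by (rule sub_leE[OF le sH tH])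
  obtain \<phi> where phi: "\<phi> \<in> Hom C b a" "monic C \<phi>"
    using iso iso_arr_monic unfolding isomorphic_def a_def b_def by blast
  have um: "monic C u"
    by (rule monic_of_comp[OF _ tH u(1)]) (use u(2) subobject_monic[OF s] in simp)
  define w where "w = u \<cdot> \<phi>"
  have w: "w \<in> Hom C b b" "monic C w"
    unfolding w_def using comp_in_Hom[OF phi(1) u(1)] monic_comp[OF um u(1) phi(2,1)] .
  \<comment> \<open>Iterating the monic endomorphism \<open>w\<close> gives a descending chain, which must become stationary.\<close>
  define c where "c i = ((\<lambda>x. x \<cdot> w) ^^ i) t" for i
  have c_Suc: "c (Suc i) = c i \<cdot> w" for i by (simp add: c_def)
  have c: "c i \<in> Hom C b M \<and> monic C (c i)" for i
  proof (induction i)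
    case 0
    then show ?case using tH subobject_monic[OF t] by (simp add: c_def)
  next
    case (Suc i)
    then show ?case
      using comp_in_Hom[OF w(1)] monic_comp[OF _ _ w(2,1)] by (auto simp: c_Suc)
  qed
  have "subobject C M (c i)" "sub_le C (c (Suc i)) (c i)" for i
    using subobjectI c sub_leI[OF _ _ w(1) c_Suc[symmetric]] by blast+
  then obtain i where "sub_le C (c i) (c (Suc i))"
    using M unfolding artinian_def wf_iff_no_infinite_down_chain sub_less_def by blast
  then obtain v where v: "v \<in> Hom C b b" "c (Suc i) \<cdot> v = c i"
    using sub_leE c by metis
  have b: "b \<in> Ob C" using in_HomD[OF u(1)] by auto
  \<comment> \<open>At the stationary stage \<open>c i\<close> factors through
    \<open>c i \<cdot> w\<close>; cancelling the monomorphism \<open>c i\<close> leaves a right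
    inverse of \<open>w\<close>.\<close>
  have "c i \<cdot> (w \<cdot> v) = c i \<cdot> Id C b"
    using comp_assoc[OF v(1) w(1), of "c i" M] v(2) c[of i] comp_id_right[of "c i" b M] c_Suc[of i] by simp
  then have "w \<cdot> v = Id C b"
    using monicD[of "c i" b M "w \<cdot> v" b "Id C b"] c comp_in_Hom[OF v(1) w(1)] id_in_Hom[OF b] by blast
  then have "u \<cdot> (\<phi> \<cdot> v) = Id C b" using comp_assoc[OF v(1) phi(1) u(1)] by (simp add: w_def)
  then have "s \<cdot> (\<phi> \<cdot> v) = t"
    using comp_assoc[OF comp_in_Hom[OF v(1) phi(1)] u(1) tH] u(2) comp_id_right[OF tH] by simp
  then show ?thesis by (rule sub_leI[OF tH sH comp_in_Hom[OF v(1) phi(1)]])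
qed

end

section \<open>The radical\<close>

context abelian_category
begin

text \<open>Correspondence between subobjects of the quotient and subobjects above \<open>K\<close>:
  the preimage \<open>t\<close> of a subobject \<open>x\<close> contains \<open>K\<close>, so it
  lies below \<open>K\<close> or is everything, and accordingly \<open>x\<close> is zero or
  invertible.\<close>

lemma maximal_quotient_simple:
  assumes K: "maximal_subobject C M K" and q: "is_cokernel C K q" "q \<in> Hom C M c"
  shows "simple C c"
proof -
  have sub: "subobject C M K" and ni: "\<not> iso_arr C K"
    and max: "\<And>t. \<lbrakk>subobject C M t; sub_le C K t\<rbrakk> \<Longrightarrow> sub_le C t K \<or> iso_arr C t"
    using K by (auto simp: maximal_subobject_def)
  note KH = subobject_in_Hom[OF sub]
  have ob: "c \<in> Ob C" "M \<in> Ob C" "Dom C K \<in> Ob C" using in_HomD[OF q(2)] in_HomD[OF KH] by auto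
  have "\<not> zero_object C c"
  proof
    assume z: "zero_object C c"
    have "epic C K"
    proof (rule epic_ZeroI[OF KH])
      fix x g assume g: "g \<in> Hom C M x" "g \<cdot> K = Zero C (Dom C K) x"
      obtain h where h: "h \<in> Hom C c x" "h \<cdot> q = g" by (rule cokernel_factor[OF q(1) KH q(2) g])
      then show "g = Zero C M x"
        using zero_object_to[OF z q(2)] comp_Zero_right[OF h(1) ob(2)] by simp
    qed
    then show False using ni monic_epic_iso[OF subobject_monic[OF sub] _ KH] by simp
  qed
  moreover have "zero_object C (Dom C x) \<or> iso_arr C x" if x: "subobject C c x" for x
  proof -
    note xH = subobject_in_Hom[OF x]
    obtain y d where y: "is_cokernel C x y" "y \<in> Hom C c d" by (rule ex_cokernel[OF xH])
    note yq = comp_in_Hom[OF q(2) y(2)]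
    obtain t e where t: "is_kernel C (y \<cdot> q) t" "t \<in> Hom C e M" by (rule ex_kernel[OF yq])
    have ob': "d \<in> Ob C" "e \<in> Ob C" "Dom C x \<in> Ob C"
      using in_HomD[OF y(2)] in_HomD[OF t(2)] in_HomD[OF xH] by auto
    have sub_t: "subobject C M t" by (rule subobjectI[OF kernel_monic[OF t(1)] t(2)])
    have "(y \<cdot> q) \<cdot> K = Zero C (Dom C K) d"
      using comp_assoc[OF KH q(2) y(2)] cokernel_comp[OF q(1) KH q(2)] comp_Zero_right[OF y(2) ob(3)] by simp
    then obtain v where "v \<in> Hom C (Dom C K) e" "t \<cdot> v = K"
      by (rule kernel_factor[OF t(1) yq t(2) KH])
    then have "sub_le C K t" by (rule sub_leI[OF KH t(2)])
    then consider "sub_le C t K" | "iso_arr C t" using max[OF sub_t] by blast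
    then show ?thesis
    proof cases
      case 1
      then obtain v where v: "v \<in> Hom C e (Dom C K)" "K \<cdot> v = t" by (rule sub_leE[OF _ t(2) KH])
      have "q \<cdot> t = Zero C e c"
        using comp_assoc[OF v(1) KH q(2)] v(2) cokernel_comp[OF q(1) KH q(2)] comp_Zero_left[OF v(1) ob(1)] by simp
      moreover have "epic C (y \<cdot> q)"
      proof (rule epic_ZeroI[OF yq])
        fix z g assume g: "g \<in> Hom C d z" "g \<cdot> (y \<cdot> q) = Zero C M z"
        have "(g \<cdot> y) \<cdot> q = Zero C M z" using comp_assoc[OF q(2) y(2) g(1)] g(2) by simp
        then have "g \<cdot> y = Zero C c z"
          by (rule epic_ZeroD[OF cokernel_epic[OF q(1)] q(2) comp_in_Hom[OF y(2) g(1)]])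
        then show "g = Zero C d z" by (rule epic_ZeroD[OF cokernel_epic[OF y(1)] y(2) g(1)])
      qed
      \<comment> \<open>Now \<open>q\<close> kills the kernel \<open>t\<close> of
        \<open>y \<cdot> q\<close>, hence factors through it. This gives \<open>y\<close> a left
        inverse, while \<open>y\<close> kills \<open>x\<close>.\<close>
      ultimately obtain w where w: "w \<in> Hom C d c" "w \<cdot> (y \<cdot> q) = q"
        using cokernel_factor[OF epic_cokernel_of_kernel[OF _ yq t] t(2) yq q(2)] by blast
      have "(w \<cdot> y) \<cdot> q = Id C c \<cdot> q"
        using comp_assoc[OF q(2) y(2) w(1)] w(2) comp_id_left[OF q(2)] by simp
      then have wy: "w \<cdot> y = Id C c"
        by (rule epicD[OF cokernel_epic[OF q(1)] q(2) comp_in_Hom[OF y(2) w(1)] id_in_Hom[OF ob(1)]])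
      have "x = w \<cdot> (y \<cdot> x)" using comp_assoc[OF xH y(2) w(1)] wy comp_id_left[OF xH] by simp
      also have "\<dots> = Zero C (Dom C x) c"
        using cokernel_comp[OF y(1) xH y(2)] comp_Zero_right[OF w(1) ob'(3)] by simp
      finally have "monic C (Zero C (Dom C x) c)" using subobject_monic[OF x] by simp
      then show ?thesis using monic_Zero_imp_zero_object[OF _ ob'(3) ob(1)] by blast
    next
      case 2
      then obtain v where v: "v \<in> Hom C M e" "t \<cdot> v = Id C M" using iso_arrE[OF _ t(2)] by blast
      have "y \<cdot> q = (y \<cdot> q) \<cdot> (t \<cdot> v)" using v(2) comp_id_right[OF yq] by simp
      also have "\<dots> = Zero C M d"
        using comp_assoc[OF v(1) t(2) yq] kernel_comp[OF t(1) yq t(2)] comp_Zero_left[OF v(1) ob'(1)] by simp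
      finally have y0: "y = Zero C c d"
        by (rule epic_ZeroD[OF cokernel_epic[OF q(1)] q(2) y(2)])
      have "epic C x"
      proof (rule epic_ZeroI[OF xH])
        fix z g assume g: "g \<in> Hom C c z" "g \<cdot> x = Zero C (Dom C x) z"
        obtain h where h: "h \<in> Hom C d z" "h \<cdot> y = g" by (rule cokernel_factor[OF y(1) xH y(2) g])
        then show "g = Zero C c z" using y0 comp_Zero_right[OF h(1) ob(1)] by simp
      qed
      then show ?thesis using monic_epic_iso[OF subobject_monic[OF x] _ xH] by simp
    qed
  qed
  ultimately show ?thesis using ob unfolding simple_def by blast
qed

text \<open>If \<open>t\<close> contains the kernel \<open>k\<close> and \<open>g\<close> does not
  vanish on it, then \<open>g \<cdot> t\<close> is already epic; containing the kernel and mapping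
  onto \<open>S\<close>, \<open>t\<close> is everything.\<close>

lemma kernel_to_simple_maximal:
  assumes g: "g \<in> Hom C M S" "simple C S" "g \<noteq> Zero C M S" and k: "is_kernel C g k" "k \<in> Hom C a M"
  shows "maximal_subobject C M k"
proof -
  note epi = to_simple_epic[OF g(2,1,3)]
  have sub: "subobject C M k" by (rule subobjectI[OF kernel_monic[OF k(1)] k(2)])
  have S: "S \<in> Ob C" using g(2) by (simp add: simple_def)
  have "\<not> iso_arr C k"
  proof
    assume "iso_arr C k"
    then obtain v where v: "v \<in> Hom C M a" "k \<cdot> v = Id C M" using iso_arrE[OF _ k(2)] by blast
    have "g = g \<cdot> (k \<cdot> v)" using v(2) comp_id_right[OF g(1)] by simp
    also have "\<dots> = Zero C M S"
      using comp_assoc[OF v(1) k(2) g(1)] kernel_comp[OF k(1) g(1) k(2)] comp_Zero_left[OF v(1) S] by simp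
    finally show False using g(3) by simp
  qed
  moreover have "sub_le C t k \<or> iso_arr C t" if t: "subobject C M t" "sub_le C k t" for t
  proof (cases "g \<cdot> t = Zero C (Dom C t) S")
    case True
    obtain u where "u \<in> Hom C (Dom C t) a" "k \<cdot> u = t"
      by (rule kernel_factor[OF k(1) g(1) k(2) subobject_in_Hom[OF t(1)] True])
    then show ?thesis using sub_leI[OF subobject_in_Hom[OF t(1)] k(2)] by blast
  next
    case False
    note tH = subobject_in_Hom[OF t(1)]
    have gt: "epic C (g \<cdot> t)" by (rule to_simple_epic[OF g(2) comp_in_Hom[OF tH g(1)] False])
    obtain u where u: "u \<in> Hom C a (Dom C t)" "t \<cdot> u = k" by (rule sub_leE[OF t(2) k(2) tH])
    have "epic C t"
    proof (rule epic_ZeroI[OF tH])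
      fix x h assume h: "h \<in> Hom C M x" "h \<cdot> t = Zero C (Dom C t) x"
      have x: "x \<in> Ob C" using in_HomD[OF h(1)] by auto
      have "h \<cdot> k = Zero C a x"
        using comp_assoc[OF u(1) tH h(1)] u(2) h(2) comp_Zero_left[OF u(1) x] by simp
      then obtain h' where h': "h' \<in> Hom C S x" "h' \<cdot> g = h"
        by (rule cokernel_factor[OF epic_cokernel_of_kernel[OF epi g(1) k] k(2) g(1) h(1)])
      have "h' \<cdot> (g \<cdot> t) = Zero C (Dom C t) x" using comp_assoc[OF tH g(1) h'(1)] h'(2) h(2) by simp
      then have "h' = Zero C S x" by (rule epic_ZeroD[OF gt comp_in_Hom[OF tH g(1)] h'(1)])
      then show "h = Zero C M x" using h'(2) comp_Zero_left[OF g(1) x] by simp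
    qed
    then show ?thesis using monic_epic_iso[OF subobject_monic[OF t(1)] _ tH] by simp
  qed
  ultimately show ?thesis using sub unfolding maximal_subobject_def by blast
qed

text \<open>Each component of \<open>f\<close> is zero or has a maximal subobject as its kernel, and
  the radical lies below all of these.\<close>

lemma radical_to_semisimple:
  assumes r: "is_radical C M r" "r \<in> Hom C a M" and f: "f \<in> Hom C M P" "semisimple C P"
  shows "f \<cdot> r = Zero C a P"
proof -
  obtain n A \<iota> \<pi> where A: "\<forall>i<n. simple C (A i)" and bp: "biproduct n A P \<iota> \<pi>"
    by (rule semisimpleE[OF f(2)])
  have ob: "a \<in> Ob C" "P \<in> Ob C" using in_HomD[OF r(2)] in_HomD[OF f(1)] by auto
  show ?thesis
  proof (rule biproduct_eqI_to[OF bp comp_in_Hom[OF r(2) f(1)] Zero_in_Hom[OF ob]])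
    fix i assume i: "i < n"
    note p = biproductD(2)[OF bp i]
    note pf = comp_in_Hom[OF f(1) p] and Ai = biproductD(5)[OF bp i]
    have "(\<pi> i \<cdot> f) \<cdot> r = Zero C a (A i)"
    proof (cases "\<pi> i \<cdot> f = Zero C M (A i)")
      case True
      then show ?thesis using comp_Zero_left[OF r(2) Ai] by simp
    next
      case False
      obtain k e where k: "is_kernel C (\<pi> i \<cdot> f) k" "k \<in> Hom C e M" by (rule ex_kernel[OF pf])
      have "sub_le C r k"
        using r(1) kernel_to_simple_maximal[OF pf _ False k] A i unfolding is_radical_def by blast
      then obtain u where u: "u \<in> Hom C a e" "k \<cdot> u = r" by (rule sub_leE[OF _ r(2) k(2)])
      then show ?thesis
        using comp_assoc[OF u(1) k(2) pf] kernel_comp[OF k(1) pf k(2)] comp_Zero_left[OF u(1) Ai] by simp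
    qed
    then show "\<pi> i \<cdot> (f \<cdot> r) = \<pi> i \<cdot> Zero C a P"
      using comp_assoc[OF r(2) f(1) p] comp_Zero_right[OF p ob(1)] by simp
  qed
qed

text \<open>A subobject that is minimal among the kernels of epimorphisms onto semisimple objects lies
  in every maximal subobject, since otherwise the two quotients could be combined.\<close>

lemma radical_quotient_semisimple:
  assumes M: "artinian M" and r: "is_radical C M r" "r \<in> Hom C a M"
  obtains P f where "f \<in> Hom C M P" "semisimple C P" "short_exact C r f"
proof -
  define ss where "ss s \<longleftrightarrow> (\<exists>P f. f \<in> Hom C M P \<and> epic C f \<and> semisimple C P \<and> is_kernel C f s)" for s
  have Mob: "M \<in> Ob C" using in_HomD[OF r(2)] by auto
  obtain Z where Z: "Z \<in> Ob C" "zero_object C Z" by (rule ex_zero_object)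
  \<comment> \<open>The morphism to a zero object makes the family \<open>ss\<close> nonempty, its
    kernel being all of \<open>M\<close>; a minimal member then exists.\<close>
  have z: "Zero C M Z \<in> Hom C M Z" by (rule Zero_in_Hom[OF Mob Z(1)])
  have "epic C (Zero C M Z)"
    by (rule epicI[OF z]) (metis zero_object_from[OF Z(2)])
  moreover obtain k0 c0 where k0: "is_kernel C (Zero C M Z) k0" "k0 \<in> Hom C c0 M" by (rule ex_kernel[OF z])
  ultimately have "ss k0" using z zero_object_semisimple[OF Z(2)] unfolding ss_def by blast
  moreover have "subobject C M k0" by (rule subobjectI[OF kernel_monic[OF k0(1)] k0(2)])
  ultimately obtain s where s: "subobject C M s" "ss s"
    and min: "\<And>t. \<lbrakk>subobject C M t; ss t\<rbrakk> \<Longrightarrow> \<not> sub_less C t s"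
    using artinian_minimal[OF M, of k0 ss] by blast
  note sH = subobject_in_Hom[OF s(1)]
  obtain P f where f: "f \<in> Hom C M P" "epic C f" "semisimple C P" "is_kernel C f s"
    using s(2) unfolding ss_def by blast
  have "sub_le C s K" if K: "maximal_subobject C M K" for K
  proof (rule ccontr)
    assume nle: "\<not> sub_le C s K"
    have sub: "subobject C M K" using K by (simp add: maximal_subobject_def)
    note KH = subobject_in_Hom[OF sub]
    obtain q S where q: "is_cokernel C K q" "q \<in> Hom C M S" by (rule ex_cokernel[OF KH])
    have qs: "q \<cdot> s \<noteq> Zero C (Dom C s) S"
    proof
      assume "q \<cdot> s = Zero C (Dom C s) S"
      then obtain u where "u \<in> Hom C (Dom C s) (Dom C K)" "K \<cdot> u = s"
        by (rule kernel_factor[OF monic_kernel_of_cokernel[OF subobject_monic[OF sub] KH q] q(2) KH sH])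
      then show False using nle sub_leI[OF sH KH] by blast
    qed
    obtain P' f' where f': "semisimple C P'" "f' \<in> Hom C M P'" "epic C f'"
      "\<And>x g. \<lbrakk>g \<in> Hom C x M; f' \<cdot> g = Zero C x P'\<rbrakk> \<Longrightarrow> f \<cdot> g = Zero C x P \<and> q \<cdot> g = Zero C x S"
      by (rule epic_extend_by_simple[OF f(1-3) sH kernel_comp[OF f(4,1) sH] q(2)
            maximal_quotient_simple[OF K q] qs]) blast
    obtain t e where t: "is_kernel C f' t" "t \<in> Hom C e M" by (rule ex_kernel[OF f'(2)])
    have sub_t: "subobject C M t" by (rule subobjectI[OF kernel_monic[OF t(1)] t(2)])
    have ft: "f \<cdot> t = Zero C e P" "q \<cdot> t = Zero C e S"
      using f'(4)[OF t(2) kernel_comp[OF t(1) f'(2) t(2)]] by auto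
    obtain u where "u \<in> Hom C e (Dom C s)" "s \<cdot> u = t"
      by (rule kernel_factor[OF f(4,1) sH t(2) ft(1)])
    then have "sub_le C t s" by (rule sub_leI[OF t(2) sH])
    moreover have "ss t" using f' t(1) unfolding ss_def by blast
    \<comment> \<open>The kernel \<open>t\<close> of the combined morphism is again in the family,
      so minimality gives \<open>s\<close> below \<open>t\<close>. But \<open>q\<close> kills
      \<open>t\<close> and does not kill \<open>s\<close>.\<close>
    ultimately have "sub_le C s t" using min[OF sub_t] unfolding sub_less_def by blast
    then obtain v where v: "v \<in> Hom C (Dom C s) e" "t \<cdot> v = s" by (rule sub_leE[OF _ sH t(2)])
    have S: "S \<in> Ob C" using in_HomD[OF q(2)] by auto
    have "q \<cdot> s = Zero C (Dom C s) S"
      using comp_assoc[OF v(1) t(2) q(2)] v(2) ft(2) comp_Zero_left[OF v(1) S] by simp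
    then show False using qs by simp
  qed
  then have "sub_le C s r" using r(1) s(1) unfolding is_radical_def by blast
  then obtain w where w: "w \<in> Hom C (Dom C s) a" "r \<cdot> w = s" by (rule sub_leE[OF _ sH r(2)])
  have rm: "monic C r" using r(1) subobject_monic unfolding is_radical_def by blast
  have fr: "f \<cdot> r = Zero C a P" by (rule radical_to_semisimple[OF r f(1,3)])
  \<comment> \<open>Being below all maximal subobjects, \<open>s\<close> is below \<open>r\<close>;
    conversely \<open>f\<close> kills \<open>r\<close>. So \<open>r\<close> can replace
    \<open>s\<close> as the kernel of \<open>f\<close>.\<close>
  have "is_kernel C f r"
  proof (rule is_kernelI[OF f(1) r(2) rm fr])
    fix x g assume g: "g \<in> Hom C x M" "f \<cdot> g = Zero C x P"
    obtain u where u: "u \<in> Hom C x (Dom C s)" "s \<cdot> u = g" by (rule kernel_factor[OF f(4,1) sH g])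
    then show "\<exists>u \<in> Hom C x a. r \<cdot> u = g"
      using comp_assoc[OF u(1) w(1) r(2)] w(2) comp_in_Hom[OF u(1) w(1)] by auto
  qed
  then have "short_exact C r f"
    using epic_cokernel_of_kernel[OF f(2,1) _ r(2)] by (simp add: short_exact_def)
  then show thesis using that[OF f(1,3)] by blast
qed

end

section \<open>Exact functors\<close>

context abelian_category
begin

text \<open>The filtrations will agree only up to mutual inclusion, while \<open>layer_arrow\<close>
  refers to chosen monomorphisms. Conjugating \<open>u\<close> and \<open>q\<close> by the
  comparison isomorphisms changes the representatives and keeps the object \<open>Q\<close>.\<close>

lemma quotient_cong:
  assumes Q: "quotient C t s Q" and sub: "subobject C M s" "subobject C M t" "subobject C M s'" "subobject C M t'"
    and le: "sub_le C s s'" "sub_le C s' s" "sub_le C t t'" "sub_le C t' t"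
  shows "quotient C t' s' Q"
proof -
  note sH = subobject_in_Hom[OF sub(1)] and tH = subobject_in_Hom[OF sub(2)]
    and sH' = subobject_in_Hom[OF sub(3)] and tH' = subobject_in_Hom[OF sub(4)]
  obtain u q where u: "u \<in> Hom C (Dom C s) (Dom C t)" "t \<cdot> u = s" and q: "is_cokernel C u q" "Cod C q = Q"
    using Q unfolding quotient_def by blast
  have qH: "q \<in> Hom C (Dom C t) Q" using cokernel_in_Hom[OF q(1) u(1)] q(2) by simp
  obtain a b where ab: "a \<in> Hom C (Dom C t) (Dom C t')" "b \<in> Hom C (Dom C t') (Dom C t)"
    "t' \<cdot> a = t" "t \<cdot> b = t'" "b \<cdot> a = Id C (Dom C t)" "a \<cdot> b = Id C (Dom C t')"
    by (rule sub_le_antisym[OF le(3,4) sub(2,4) tH tH'])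
  obtain c d where cd: "c \<in> Hom C (Dom C s) (Dom C s')" "d \<in> Hom C (Dom C s') (Dom C s)"
    "s' \<cdot> c = s" "s \<cdot> d = s'" "d \<cdot> c = Id C (Dom C s)" "c \<cdot> d = Id C (Dom C s')"
    by (rule sub_le_antisym[OF le(1,2) sub(1,3) sH sH'])
  note ud = comp_in_Hom[OF cd(2) u(1)]
  note aud = comp_in_Hom[OF ud ab(1)] and qb = comp_in_Hom[OF ab(2) qH]
  have ob: "Dom C s \<in> Ob C" "Dom C s' \<in> Ob C" "Q \<in> Ob C"
    using in_HomD[OF sH] in_HomD[OF sH'] in_HomD[OF qH] by auto
  have "t' \<cdot> (a \<cdot> (u \<cdot> d)) = s'"
    using comp_assoc[OF ud ab(1) tH'] comp_assoc[OF cd(2) u(1) tH] ab cd u by simp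
  moreover have "is_cokernel C (a \<cdot> (u \<cdot> d)) (q \<cdot> b)"
  proof (rule is_cokernelI[OF aud qb])
    have baud: "b \<cdot> (a \<cdot> (u \<cdot> d)) = u \<cdot> d"
      using comp_assoc[OF ud ab(1,2)] ab(5) comp_id_left[OF ud] by simp
    show "q \<cdot> b \<cdot> (a \<cdot> (u \<cdot> d)) = Zero C (Dom C s') Q"
      using comp_assoc[OF aud ab(2) qH] baud comp_assoc[OF cd(2) u(1) qH]
        cokernel_comp[OF q(1) u(1) qH] comp_Zero_left[OF cd(2) ob(3)] by simp
    show "epic C (q \<cdot> b)"
    proof (rule epic_ZeroI[OF qb])
      fix x g assume g: "g \<in> Hom C Q x" "g \<cdot> (q \<cdot> b) = Zero C (Dom C t') x"
      have x: "x \<in> Ob C" using in_HomD[OF g(1)] by auto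
      have "g \<cdot> q = ((g \<cdot> q) \<cdot> b) \<cdot> a"
        using comp_assoc[OF ab(1,2) comp_in_Hom[OF qH g(1)]] ab(5) comp_id_right[OF comp_in_Hom[OF qH g(1)]] by simp
      also have "\<dots> = Zero C (Dom C t) x"
        using comp_assoc[OF ab(2) qH g(1)] g(2) comp_Zero_left[OF ab(1) x] by simp
      finally show "g = Zero C Q x" by (rule epic_ZeroD[OF cokernel_epic[OF q(1)] qH g(1)])
    qed
    fix x g assume g: "g \<in> Hom C (Dom C t') x" "g \<cdot> (a \<cdot> (u \<cdot> d)) = Zero C (Dom C s') x"
    have x: "x \<in> Ob C" using in_HomD[OF g(1)] by auto
    note ga = comp_in_Hom[OF ab(1) g(1)]
    have "(g \<cdot> a) \<cdot> u = ((g \<cdot> a) \<cdot> u) \<cdot> (d \<cdot> c)"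
      using cd(5) comp_id_right[OF comp_in_Hom[OF u(1) ga]] by simp
    also have "\<dots> = (g \<cdot> (a \<cdot> (u \<cdot> d))) \<cdot> c"
      using comp_assoc[OF cd(1,2) comp_in_Hom[OF u(1) ga]] comp_assoc[OF cd(2) u(1) ga]
        comp_assoc[OF ud ab(1) g(1)] by simp
    also have "\<dots> = Zero C (Dom C s) x" using g(2) comp_Zero_left[OF cd(1) x] by simp
    finally obtain v where v: "v \<in> Hom C Q x" "v \<cdot> q = g \<cdot> a"
      by (rule cokernel_factor[OF q(1) u(1) qH ga])
    have "v \<cdot> (q \<cdot> b) = g"
      using comp_assoc[OF ab(2) qH v(1)] v(2) comp_assoc[OF ab(2,1) g(1)] ab(6) comp_id_right[OF g(1)] by simp
    then show "\<exists>u \<in> Hom C Q x. u \<cdot> (q \<cdot> b) = g" using v(1) by blast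
  qed
  moreover have "Cod C (q \<cdot> b) = Q" using in_HomD[OF qb] by simp
  ultimately show ?thesis unfolding quotient_def using aud by blast
qed

lemma loewy_length_1:
  assumes M: "semisimple C M" "\<not> zero_object C M"
  shows "loewy_length C M 1"
proof -
  have Mob: "M \<in> Ob C" by (rule semisimple_Ob[OF M(1)])
  obtain Z where Z: "Z \<in> Ob C" "zero_object C Z" by (rule ex_zero_object)
  have z: "Zero C Z M \<in> Hom C Z M" by (rule Zero_in_Hom[OF Z(1) Mob])
  note i = id_in_Hom[OF Mob]
  define m where "m k = (if k = 0 then Zero C Z M else Id C M)" for k :: nat
  \<comment> \<open>This excludes a series of length 0, in which the single member would be both
    zero and all of \<open>M\<close>.\<close>
  have iso: "\<not> iso_arr C s" if s: "zero_object C (Dom C s)" "s \<in> Hom C (Dom C s) M" for s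
  proof
    assume "iso_arr C s"
    then obtain g where g: "g \<in> Hom C M (Dom C s)" "s \<cdot> g = Id C M"
      using iso_arrE[OF _ s(2)] by blast
    then have "Id C M = Zero C M M"
      using zero_object_from[OF s] comp_Zero_left[OF g(1) Mob] by simp
    then show False using M(2) Mob by (simp add: zero_object_iff)
  qed
  have "quotient C (m (Suc 0)) (m 0) M"
  proof -
    have "is_cokernel C (Zero C Z M) (Id C M)"
      by (rule is_cokernelI[OF z i])
        (use comp_id_left[OF z] comp_id_right i in \<open>auto intro!: epicI[OF i]\<close>)
    then show ?thesis
      unfolding quotient_def using z in_HomD[OF z] in_HomD[OF i] comp_id_left[OF z] by (auto simp: m_def)
  qed
  moreover have "subobject C M (m k)" for k
    using subobjectI[OF zero_object_monic[OF Z(2) Mob] z] subobjectI[OF iso_arr_monic[OF iso_arr_Id[OF Mob]] i]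
    by (simp add: m_def)
  moreover have "\<not> sub_le C (Id C M) (Zero C Z M)"
  proof
    assume "sub_le C (Id C M) (Zero C Z M)"
    then obtain u where u: "u \<in> Hom C M Z" "Zero C Z M \<cdot> u = Id C M" by (rule sub_leE[OF _ i z])
    then show False using comp_Zero_left[OF u(1) Mob] M(2) Mob by (simp add: zero_object_iff)
  qed
  ultimately have "semisimple_series C M 1 m"
    unfolding semisimple_series_def series_def
    using M(1) Z(2) in_HomD[OF z] iso_arr_Id[OF Mob] sub_leI[OF z i z comp_id_left[OF z]]
    by (auto simp: m_def sub_less_def)
  moreover have "1 \<le> n'" if "semisimple_series C M n' m'" for n' m'
    using that iso[of "m' 0"] subobject_in_Hom unfolding semisimple_series_def series_def
    by (cases n') auto
  ultimately show ?thesis unfolding loewy_length_def by blast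
qed

lemma loewy_length_1_imp_semisimple:
  assumes "loewy_length C M 1"
  shows "semisimple C M"
proof -
  obtain m where "semisimple_series C M 1 m"
    using assms unfolding loewy_length_def by blast
  then obtain Q where m: "subobject C M (m 0)" "subobject C M (m 1)" "zero_object C (Dom C (m 0))" "iso_arr C (m 1)"
    and Q: "quotient C (m 1) (m 0) Q" "semisimple C Q"
    unfolding semisimple_series_def series_def by auto
  note mH = subobject_in_Hom[OF m(2)]
  obtain u q where u: "u \<in> Hom C (Dom C (m 0)) (Dom C (m 1))" and q: "q \<in> Hom C (Dom C (m 1)) Q"
    and ex: "short_exact C u q"
    by (rule quotient_short_exact[OF Q(1) m(1,2)])
  have qm: "monic C q"
  proof (rule monic_ZeroI[OF q])
    fix x g assume g: "g \<in> Hom C x (Dom C (m 1))" "q \<cdot> g = Zero C x Q"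
    obtain v where v: "v \<in> Hom C x (Dom C (m 0))" "u \<cdot> v = g"
      using kernel_factor[OF _ q u g] ex unfolding short_exact_def by blast
    then show "g = Zero C x (Dom C (m 1))"
      using zero_object_to[OF m(3) v(1)] comp_Zero_right[OF u] in_HomD[OF v(1)] by simp
  qed
  have "epic C q" using ex cokernel_epic unfolding short_exact_def by blast
  then obtain h where h: "h \<in> Hom C Q (Dom C (m 1))" "h \<cdot> q = Id C (Dom C (m 1))" "q \<cdot> h = Id C Q"
    using iso_arrE[OF monic_epic_iso[OF qm _ q] q] by blast
  then have "semisimple C (Dom C (m 1))" using semisimple_iso[OF Q(2) h(1) q] by simp
  moreover obtain g where "g \<in> Hom C M (Dom C (m 1))" "g \<cdot> m 1 = Id C (Dom C (m 1))" "m 1 \<cdot> g = Id C M"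
    by (rule iso_arrE[OF m(4) mH])
  ultimately show ?thesis using semisimple_iso[OF _ mH] by blast
qed

end

section \<open>Transport of subobjects, filtration steps and arrows along the functor\<close>

locale strong_exact_abelian_functor =
  source: abelian_category C + target: abelian_category D + strong_exact_functor C D Fo Fa
  for C :: "('o, 'm, 'z) precat_scheme"
    and D :: "('p, 'n, 'y) precat_scheme"
    and Fo :: "'o \<Rightarrow> 'p" and Fa :: "'m \<Rightarrow> 'n"
begin

text \<open>Exactness speaks about short exact sequences only, so the monomorphism is first
  completed by its cokernel.\<close>

lemma F_monic:
  assumes "monic C f" "f \<in> Hom C a b"
  shows "monic D (Fa f)"
proof -
  obtain q c where q: "is_cokernel C f q" "q \<in> Hom C b c" by (rule source.ex_cokernel[OF assms(2)])
  then have "short_exact C f q"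
    using source.monic_kernel_of_cokernel[OF assms q] by (simp add: short_exact_def)
  then show ?thesis
    using F_exact target.kernel_monic unfolding short_exact_def by blast
qed

lemma F_epic:
  assumes "epic C f" "f \<in> Hom C a b"
  shows "epic D (Fa f)"
proof -
  obtain k c where k: "is_kernel C f k" "k \<in> Hom C c a" by (rule source.ex_kernel[OF assms(2)])
  then have "short_exact C k f"
    using source.epic_cokernel_of_kernel[OF assms k] by (simp add: short_exact_def)
  then show ?thesis
    using F_exact target.cokernel_epic unfolding short_exact_def by blast
qed

text \<open>The functor axioms do not mention zero morphisms. For a zero object, however, two copies
  of the identity form a short exact sequence; its image consists of identities again, and their
  composite being zero forces the identity to be zero.\<close>

lemma F_zero_object:
  assumes "zero_object C Z"
  shows "zero_object D (Fo Z)"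
proof -
  have Z: "Z \<in> Ob C" "Id C Z = Zero C Z Z" using assms by (auto simp: source.zero_object_iff)
  have i: "Id C Z \<in> Hom C Z Z" by (rule source.id_in_Hom[OF Z(1)])
  have eq: "f = g" if "f \<in> Hom C x Z" "g \<in> Hom C x Z" for f g x
    using source.zero_object_to[OF assms] that by metis
  have eq': "f = g" if "f \<in> Hom C Z x" "g \<in> Hom C Z x" for f g x
    using source.zero_object_from[OF assms] that by metis
  have m: "monic C (Id C Z)" by (rule source.monicI[OF i]) (rule eq)
  have e: "epic C (Id C Z)" by (rule source.epicI[OF i]) (rule eq')
  have "Id C Z \<cdot>\<^bsub>C\<^esub> Id C Z = Zero C Z Z" using Z(2) source.comp_id_left[OF i] by simp
  then have "short_exact C (Id C Z) (Id C Z)"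
    unfolding short_exact_def
    using source.is_kernelI[OF i i m] source.is_cokernelI[OF i i e]
      source.comp_id_left source.comp_id_right by blast
  then have "is_kernel D (Id D (Fo Z)) (Id D (Fo Z))"
    using F_exact F_id[OF Z(1)] unfolding short_exact_def by fastforce
  moreover have "Id D (Fo Z) \<in> Hom D (Fo Z) (Fo Z)" by (rule target.id_in_Hom[OF F_ob[OF Z(1)]])
  ultimately show ?thesis
    using target.kernel_comp target.comp_id_left F_ob[OF Z(1)]
    unfolding target.zero_object_iff by metis
qed

lemma F_subobject:
  assumes "subobject C M s"
  shows "subobject D (Fo M) (Fa s)" "Fa s \<in> Hom D (Fo (Dom C s)) (Fo M)"
proof -
  note sH = source.subobject_in_Hom[OF assms]
  show FsH: "Fa s \<in> Hom D (Fo (Dom C s)) (Fo M)" by (rule F_hom[OF sH])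
  show "subobject D (Fo M) (Fa s)"
    by (rule target.subobjectI[OF F_monic[OF source.subobject_monic[OF assms] sH] FsH])
qed

lemma F_Dom: "subobject C M s \<Longrightarrow> Dom D (Fa s) = Fo (Dom C s)"
  using target.in_HomD(2)[OF F_subobject(2)] .

lemma F_quotient:
  assumes "quotient C t s Q" "subobject C M s" "subobject C M t"
  shows "quotient D (Fa t) (Fa s) (Fo Q)"
proof -
  obtain u q where u: "u \<in> Hom C (Dom C s) (Dom C t)" "t \<cdot>\<^bsub>C\<^esub> u = s"
    and q: "q \<in> Hom C (Dom C t) Q" "short_exact C u q"
    by (rule source.quotient_short_exact[OF assms])
  have "Fa u \<in> Hom D (Dom D (Fa s)) (Dom D (Fa t))"
    using F_hom[OF u(1)] F_Dom assms(2,3) by simp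
  moreover have "Fa t \<cdot>\<^bsub>D\<^esub> Fa u = Fa s"
    using F_comp[OF u(1) source.subobject_in_Hom[OF assms(3)]] u(2) by simp
  moreover have "is_cokernel D (Fa u) (Fa q)" "Cod D (Fa q) = Fo Q"
    using F_exact[OF q(2)] target.in_HomD(3)[OF F_hom[OF q(1)]] by (auto simp: short_exact_def)
  ultimately show ?thesis unfolding quotient_def by blast
qed

lemma F_subquotient:
  assumes "subquotient C M Z"
  shows "subquotient D (Fo M) (Fo Z)"
proof -
  obtain i p where i: "subobject C M i" and p: "epic C p" "Dom C p = Dom C i" "Cod C p = Z"
    using assms unfolding subquotient_def by blast
  then have pH: "p \<in> Hom C (Dom C i) Z" by (simp add: epic_def Hom_def)
  show ?thesis
    unfolding subquotient_def
    using F_subobject(1)[OF i] F_epic[OF p(1) pH] target.in_HomD(2,3)[OF F_hom[OF pH]] F_Dom[OF i] by metis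
qed

text \<open>Exactness carries over all quotients and subquotients that an arrow mentions, and strong
  exactness the failure to split. Mutual inclusion then allows the images \<open>Fa (m i)\<close> to
  be replaced by the members \<open>m' i\<close>.\<close>

lemma F_layer_arrow:
  assumes arrow: "layer_arrow C n m k A B"
    and m: "\<And>i. i \<le> n \<Longrightarrow> subobject C M (m i)" and m': "\<And>i. i \<le> n \<Longrightarrow> subobject D (Fo M) (m' i)"
    and le: "\<And>i. i \<le> n \<Longrightarrow> sub_le D (Fa (m i)) (m' i)" "\<And>i. i \<le> n \<Longrightarrow> sub_le D (m' i) (Fa (m i))"
  shows "layer_arrow D n m' k (Fo A) (Fo B)"
proof -
  have k: "2 \<le> k" "k \<le> n" using arrow by (auto simp: layer_arrow_def)
  have Q: "quotient D (m' i) (m' j) (Fo Q)" if "quotient C (m i) (m j) Q" "i \<le> n" "j \<le> n" for i j Q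
    by (rule target.quotient_cong[OF F_quotient[OF that(1) m m] F_subobject(1)[OF m] F_subobject(1)[OF m] m' m' le le])
      (use that in auto)
  obtain Q1 Q2 Q3 Z f g where
    1: "quotient C (m k) (m (k - 1)) Q1" "subquotient C Q1 A" and
    2: "quotient C (m (k - 1)) (m (k - 2)) Q2" "subquotient C Q2 B" and
    3: "quotient C (m k) (m (k - 2)) Q3" "subquotient C Q3 Z" and
    fg: "f \<in> Hom C B Z" "g \<in> Hom C Z A" "short_exact C f g" "\<not> splits C f g"
    using arrow unfolding layer_arrow_def by blast
  have "Fa f \<in> Hom D (Fo B) (Fo Z)" "Fa g \<in> Hom D (Fo Z) (Fo A)"
    "short_exact D (Fa f) (Fa g)" "\<not> splits D (Fa f) (Fa g)"
    using F_hom fg F_exact F_strong by auto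
  moreover have "quotient D (m' k) (m' (k - 1)) (Fo Q1)" "quotient D (m' (k - 1)) (m' (k - 2)) (Fo Q2)"
    "quotient D (m' k) (m' (k - 2)) (Fo Q3)"
    using Q 1(1) 2(1) 3(1) k by auto
  ultimately show ?thesis
    unfolding layer_arrow_def
    using k F_subquotient[OF 1(2)] F_subquotient[OF 2(2)] F_subquotient[OF 3(2)] by blast
qed

text \<open>Loewy length 1 is preserved and characterises nonzero semisimple objects; the zero
  object is treated apart because its Loewy length is 0.\<close>

lemma F_semisimple:
  assumes len: "\<And>X n. \<lbrakk>X \<in> Ob C; loewy_length C X n\<rbrakk> \<Longrightarrow> loewy_length D (Fo X) n"
    and S: "semisimple C S"
  shows "semisimple D (Fo S)"
proof (cases "zero_object C S")
  case True
  then show ?thesis using F_zero_object target.zero_object_semisimple by blast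
next
  case False
  then show ?thesis
    using target.loewy_length_1_imp_semisimple len source.loewy_length_1[OF S] source.semisimple_Ob[OF S] by blast
qed

text \<open>When \<open>Fa s\<close> and \<open>s'\<close> are equal as subobjects, their cokernels
  are identified. The image of the socle of \<open>M / s\<close> is a semisimple subobject there,
  hence below the socle of the target quotient, and this inclusion lifts to the preimages
  \<open>Fa t\<close> and \<open>t'\<close>.\<close>

lemma F_socle_step:
  assumes ss: "\<And>S. semisimple C S \<Longrightarrow> semisimple D (Fo S)"
    and s: "subobject C M s" "subobject C M t" "socle_step C s t"
    and s': "subobject D (Fo M) s'" "subobject D (Fo M) t'" "socle_step D s' t'"
    and le: "sub_le D (Fa s) s'" "sub_le D s' (Fa s)"
  shows "sub_le D (Fa t) t'"
proof -
  note sH = source.subobject_in_Hom[OF s(1)] and tH = source.subobject_in_Hom[OF s(2)]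
    and sH' = target.subobject_in_Hom[OF s'(1)] and tH' = target.subobject_in_Hom[OF s'(2)]
    and FsH = F_subobject(2)[OF s(1)] and FtH = F_subobject(2)[OF s(2)]
  obtain u c q j where u: "u \<in> Hom C (Dom C s) (Dom C t)" "t \<cdot>\<^bsub>C\<^esub> u = s"
    and c: "is_cokernel C u c" and q: "is_cokernel C s q"
    and j: "j \<in> Hom C (Cod C c) (Cod C q)" "j \<cdot>\<^bsub>C\<^esub> c = q \<cdot>\<^bsub>C\<^esub> t" "is_socle C (Cod C q) j"
    using s(3) unfolding socle_step_def by blast
  obtain u' c' q' j' where u': "u' \<in> Hom D (Dom D s') (Dom D t')" "t' \<cdot>\<^bsub>D\<^esub> u' = s'"
    and c': "is_cokernel D u' c'" and q': "is_cokernel D s' q'"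
    and j': "j' \<in> Hom D (Cod D c') (Cod D q')" "j' \<cdot>\<^bsub>D\<^esub> c' = q' \<cdot>\<^bsub>D\<^esub> t'" "is_socle D (Cod D q') j'"
    using s'(3) unfolding socle_step_def by blast
  note cH = source.cokernel_in_Hom[OF c u(1)] and qH = source.cokernel_in_Hom[OF q sH]
    and cH' = target.cokernel_in_Hom[OF c' u'(1)] and qH' = target.cokernel_in_Hom[OF q' sH']
  note FqH = F_hom[OF qH] and FcH = F_hom[OF cH] and FjH = F_hom[OF j(1)]
  have "short_exact C s q"
    using source.monic_kernel_of_cokernel[OF source.subobject_monic[OF s(1)] sH q qH] q
    by (simp add: short_exact_def)
  then have Fq: "is_cokernel D (Fa s) (Fa q)" using F_exact by (simp add: short_exact_def)
  have Q'ob: "Cod D q' \<in> Ob D" "Fo (Dom C s) \<in> Ob D" "Dom D s' \<in> Ob D"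
    using target.in_HomD[OF qH'] target.in_HomD[OF FsH] target.in_HomD[OF sH'] by auto
  have FqOb: "Fo (Cod C q) \<in> Ob D" using target.in_HomD[OF FqH] by auto
  obtain a b where ab: "a \<in> Hom D (Fo (Dom C s)) (Dom D s')" "b \<in> Hom D (Dom D s') (Fo (Dom C s))"
    "s' \<cdot>\<^bsub>D\<^esub> a = Fa s" "Fa s \<cdot>\<^bsub>D\<^esub> b = s'"
    by (rule target.sub_le_antisym[OF le F_subobject(1)[OF s(1)] s'(1) FsH sH'])
  have "q' \<cdot>\<^bsub>D\<^esub> Fa s = Zero D (Fo (Dom C s)) (Cod D q')"
    using target.comp_assoc[OF ab(1) sH' qH'] ab(3) target.cokernel_comp[OF q' sH' qH']
      target.comp_Zero_left[OF ab(1) Q'ob(1)] by simp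
  \<comment> \<open>\<open>\<theta>\<close> compares the two quotients of \<open>Fo M\<close>; the
    left inverse \<open>\<eta>\<close> constructed next shows that it is monic.\<close>
  then obtain \<theta> where th: "\<theta> \<in> Hom D (Fo (Cod C q)) (Cod D q')" "\<theta> \<cdot>\<^bsub>D\<^esub> Fa q = q'"
    by (rule target.cokernel_factor[OF Fq FsH FqH qH'])
  have "Fa q \<cdot>\<^bsub>D\<^esub> s' = Zero D (Dom D s') (Fo (Cod C q))"
    using target.comp_assoc[OF ab(2) FsH FqH] ab(4) target.cokernel_comp[OF Fq FsH FqH]
      target.comp_Zero_left[OF ab(2) FqOb] by simp
  then obtain \<eta> where et: "\<eta> \<in> Hom D (Cod D q') (Fo (Cod C q))" "\<eta> \<cdot>\<^bsub>D\<^esub> q' = Fa q"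
    by (rule target.cokernel_factor[OF q' sH' qH' FqH])
  have "(\<eta> \<cdot>\<^bsub>D\<^esub> \<theta>) \<cdot>\<^bsub>D\<^esub> Fa q = Id D (Fo (Cod C q)) \<cdot>\<^bsub>D\<^esub> Fa q"
    using target.comp_assoc[OF FqH th(1) et(1)] th(2) et(2) target.comp_id_left[OF FqH] by simp
  then have "\<eta> \<cdot>\<^bsub>D\<^esub> \<theta> = Id D (Fo (Cod C q))"
    by (rule target.epicD[OF target.cokernel_epic[OF Fq] FqH target.comp_in_Hom[OF th(1) et(1)] target.id_in_Hom[OF FqOb]])
  then have mono_th: "monic D \<theta>"
    using target.monic_of_comp[OF _ et(1) th(1)] target.iso_arr_monic[OF target.iso_arr_Id[OF FqOb]] by simp
  note thj = target.comp_in_Hom[OF FjH th(1)]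
  have jm: "monic C j" "semisimple C (Cod C c)"
    using j(3) source.in_HomD(2)[OF j(1)] unfolding is_socle_def subobject_def by auto
  have "subobject D (Cod D q') (\<theta> \<cdot>\<^bsub>D\<^esub> Fa j)"
    by (rule target.subobjectI[OF target.monic_comp[OF mono_th th(1) F_monic[OF jm(1) j(1)] FjH] thj])
  moreover have "semisimple D (Dom D (\<theta> \<cdot>\<^bsub>D\<^esub> Fa j))"
    using ss[OF jm(2)] target.in_HomD(2)[OF thj] by simp
  ultimately have "sub_le D (\<theta> \<cdot>\<^bsub>D\<^esub> Fa j) j'" using j'(3) unfolding is_socle_def by blast
  then obtain v where v: "v \<in> Hom D (Fo (Cod C c)) (Cod D c')" "j' \<cdot>\<^bsub>D\<^esub> v = \<theta> \<cdot>\<^bsub>D\<^esub> Fa j"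
    by (rule target.sub_leE[OF _ thj j'(1)])
  \<comment> \<open>It remains to see that the cokernel \<open>d\<close> of \<open>t'\<close> kills \<open>Fa t\<close>.\<close>
  obtain d e where d: "is_cokernel D t' d" "d \<in> Hom D (Fo M) e" by (rule target.ex_cokernel[OF tH'])
  have eob: "e \<in> Ob D" using target.in_HomD[OF d(2)] by auto
  have dt': "d \<cdot>\<^bsub>D\<^esub> t' = Zero D (Dom D t') e" by (rule target.cokernel_comp[OF d(1) tH' d(2)])
  have "d \<cdot>\<^bsub>D\<^esub> s' = Zero D (Dom D s') e"
    using target.comp_assoc[OF u'(1) tH' d(2)] u'(2) dt' target.comp_Zero_left[OF u'(1) eob] by simp
  \<comment> \<open>Since \<open>d\<close> kills \<open>s'\<close>, it factors through
    \<open>q'\<close>; the factor \<open>w\<close> kills the socle \<open>j'\<close>, and modulo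
    \<open>s'\<close> the morphism \<open>Fa t\<close> lands in that socle.\<close>
  then obtain w where w: "w \<in> Hom D (Cod D q') e" "w \<cdot>\<^bsub>D\<^esub> q' = d"
    by (rule target.cokernel_factor[OF q' sH' qH' d(2)])
  note wj = target.comp_in_Hom[OF j'(1) w(1)]
  have "(w \<cdot>\<^bsub>D\<^esub> j') \<cdot>\<^bsub>D\<^esub> c' = Zero D (Dom D t') e"
    using target.comp_assoc[OF cH' j'(1) w(1)] j'(2) target.comp_assoc[OF tH' qH' w(1)] w(2) dt' by simp
  then have wj0: "w \<cdot>\<^bsub>D\<^esub> j' = Zero D (Cod D c') e"
    by (rule target.epic_ZeroD[OF target.cokernel_epic[OF c'] cH' wj])
  have qt: "q' \<cdot>\<^bsub>D\<^esub> Fa t = j' \<cdot>\<^bsub>D\<^esub> (v \<cdot>\<^bsub>D\<^esub> Fa c)"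
  proof -
    have "q' \<cdot>\<^bsub>D\<^esub> Fa t = \<theta> \<cdot>\<^bsub>D\<^esub> (Fa q \<cdot>\<^bsub>D\<^esub> Fa t)"
      using target.comp_assoc[OF FtH FqH th(1)] th(2) by simp
    also have "Fa q \<cdot>\<^bsub>D\<^esub> Fa t = Fa j \<cdot>\<^bsub>D\<^esub> Fa c"
      using F_comp[OF tH qH] F_comp[OF cH j(1)] j(2) by simp
    also have "\<theta> \<cdot>\<^bsub>D\<^esub> (Fa j \<cdot>\<^bsub>D\<^esub> Fa c) = j' \<cdot>\<^bsub>D\<^esub> (v \<cdot>\<^bsub>D\<^esub> Fa c)"
      using target.comp_assoc[OF FcH FjH th(1)] target.comp_assoc[OF FcH v(1) j'(1)] v(2) by simp
    finally show ?thesis .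
  qed
  note vc = target.comp_in_Hom[OF FcH v(1)]
  have "d \<cdot>\<^bsub>D\<^esub> Fa t = w \<cdot>\<^bsub>D\<^esub> (j' \<cdot>\<^bsub>D\<^esub> (v \<cdot>\<^bsub>D\<^esub> Fa c))"
    using target.comp_assoc[OF FtH qH' w(1)] w(2) qt by simp
  also have "\<dots> = Zero D (Fo (Dom C t)) e"
    using target.comp_assoc[OF vc j'(1) w(1)] wj0 target.comp_Zero_left[OF vc eob] by simp
  finally obtain y where "y \<in> Hom D (Fo (Dom C t)) (Dom D t')" "t' \<cdot>\<^bsub>D\<^esub> y = Fa t"
    by (rule target.kernel_factor[OF target.monic_kernel_of_cokernel[OF target.subobject_monic[OF s'(2)] tH' d] d(2) tH' FtH])
  then show ?thesis by (rule target.sub_leI[OF FtH tH'])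
qed

text \<open>The quotient of \<open>s\<close> by its radical is a semisimple \<open>P\<close>, and
  \<open>Fo P\<close> is semisimple again. The radical of \<open>s'\<close> vanishes in every
  semisimple object, in particular under \<open>s'\<close> -> \<open>Fa s\<close> ->
  \<open>Fo P\<close>, so it lands in the kernel \<open>Fa r\<close>.\<close>

lemma F_radical_step:
  assumes ss: "\<And>S. semisimple C S \<Longrightarrow> semisimple D (Fo S)"
    and s: "subobject C M s" "is_radical C (Dom C s) r" "source.artinian (Dom C s)"
    and s': "subobject D (Fo M) s'" "is_radical D (Dom D s') r'"
    and le: "sub_le D s' (Fa s)"
  shows "sub_le D (s' \<cdot>\<^bsub>D\<^esub> r') (Fa (s \<cdot>\<^bsub>C\<^esub> r))"
proof -
  note sH = source.subobject_in_Hom[OF s(1)] and sH' = target.subobject_in_Hom[OF s'(1)]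
    and FsH = F_subobject(2)[OF s(1)]
  have rH: "r \<in> Hom C (Dom C r) (Dom C s)" and rH': "r' \<in> Hom D (Dom D r') (Dom D s')"
    using s(2) s'(2) source.subobject_in_Hom target.subobject_in_Hom unfolding is_radical_def by blast+
  obtain P f where f: "f \<in> Hom C (Dom C s) P" "semisimple C P" "short_exact C r f"
    by (rule source.radical_quotient_semisimple[OF s(3,2) rH])
  have k: "is_kernel D (Fa f) (Fa r)" using F_exact[OF f(3)] by (simp add: short_exact_def)
  note FfH = F_hom[OF f(1)] and FrH = F_hom[OF rH]
  obtain b where b: "b \<in> Hom D (Dom D s') (Fo (Dom C s))" "Fa s \<cdot>\<^bsub>D\<^esub> b = s'"
    by (rule target.sub_leE[OF le sH' FsH])
  note br = target.comp_in_Hom[OF rH' b(1)]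
  have "(Fa f \<cdot>\<^bsub>D\<^esub> b) \<cdot>\<^bsub>D\<^esub> r' = Zero D (Dom D r') (Fo P)"
    by (rule target.radical_to_semisimple[OF s'(2) rH' target.comp_in_Hom[OF b(1) FfH] ss[OF f(2)]])
  then have "Fa f \<cdot>\<^bsub>D\<^esub> (b \<cdot>\<^bsub>D\<^esub> r') = Zero D (Dom D r') (Fo P)"
    using target.comp_assoc[OF rH' b(1) FfH] by simp
  then obtain v where v: "v \<in> Hom D (Dom D r') (Fo (Dom C r))" "Fa r \<cdot>\<^bsub>D\<^esub> v = b \<cdot>\<^bsub>D\<^esub> r'"
    by (rule target.kernel_factor[OF k FfH FrH br])
  have "Fa (s \<cdot>\<^bsub>C\<^esub> r) \<cdot>\<^bsub>D\<^esub> v = s' \<cdot>\<^bsub>D\<^esub> r'"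
    using F_comp[OF rH sH] target.comp_assoc[OF v(1) FrH FsH] v(2) target.comp_assoc[OF rH' b(1) FsH] b(2) by simp
  then show ?thesis
    by (rule target.sub_leI[OF target.comp_in_Hom[OF rH' sH'] F_hom[OF source.comp_in_Hom[OF rH sH]] v(1)])
qed

section \<open>Agreement of the filtrations and preservation of the diagrams\<close>

lemma socle_diagrams:
  assumes F: "preserves_socle_filtrations C D Fo"
  shows "preserves_socle_diagrams C D Fo"
  unfolding preserves_socle_diagrams_def
proof (intro ballI allI impI)
  fix X k A B assume X: "X \<in> Ob C" and arrow: "socle_diagram_arrow C X k A B"
  obtain n m where m: "socle_filtration C X n m" and la: "layer_arrow C n m k A B"
    using arrow unfolding socle_diagram_arrow_def socle_layer_arrow_def by blast
  have len: "loewy_length D (Fo X) n" if "X \<in> Ob C" "loewy_length C X n" for X n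
    using F that unfolding preserves_socle_filtrations_def by blast
  note ss = F_semisimple[OF len]
  have lX: "loewy_length C X n" using m unfolding socle_filtration_def by blast
  obtain m' where m': "socle_filtration D (Fo X) n m'"
    and iso: "\<And>i. i \<in> {1..n} \<Longrightarrow> isomorphic D (Fo (Dom C (m i))) (Dom D (m' i))"
    using F X lX m unfolding preserves_socle_filtrations_def by blast
  have art: "target.artinian (Fo X)"
    using len[OF X lX] target.semisimple_series_artinian unfolding loewy_length_def by blast
  have sub: "\<And>i. i \<le> n \<Longrightarrow> subobject C X (m i)" "\<And>i. i \<le> n \<Longrightarrow> subobject D (Fo X) (m' i)"
    using m m' unfolding socle_filtration_def by blast+
  \<comment> \<open>Both inclusions go through the induction together, because the next socle step
    compares quotients by the current members. Index 0 is not covered by \<open>iso\<close>; there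
    both members are zero.\<close>
  have le: "sub_le D (Fa (m i)) (m' i) \<and> sub_le D (m' i) (Fa (m i))" if "i \<le> n" for i
    using that
  proof (induction i)
    case 0
    have "zero_object C (Dom C (m 0))" "zero_object D (Dom D (m' 0))"
      using m m' unfolding socle_filtration_def by blast+
    then show ?case
      using target.zero_object_sub_le F_subobject(2)[OF sub(1)[OF 0]] target.subobject_in_Hom[OF sub(2)[OF 0]]
        F_zero_object F_Dom[OF sub(1)[OF 0]] by metis
  next
    case (Suc i)
    have "socle_step C (m i) (m (Suc i))" "socle_step D (m' i) (m' (Suc i))"
      using m m' Suc.prems unfolding socle_filtration_def by auto
    then have *: "sub_le D (Fa (m (Suc i))) (m' (Suc i))"
      using F_socle_step[OF ss sub(1) sub(1) _ sub(2) sub(2)] Suc.IH Suc.prems by (meson Suc_leD)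
    have "isomorphic D (Dom D (m' (Suc i))) (Dom D (Fa (m (Suc i))))"
      using target.isomorphic_sym[OF iso[of "Suc i"]] F_Dom[OF sub(1)[OF Suc.prems]] Suc.prems by simp
    then show ?case
      using * target.artinian_isomorphic_sub_le[OF art F_subobject(1)[OF sub(1)[OF Suc.prems]] sub(2)[OF Suc.prems]]
      by blast
  qed
  have "layer_arrow D n m' k (Fo A) (Fo B)"
    by (rule F_layer_arrow[OF la sub]) (use le in auto)
  then show "socle_layer_arrow D (Fo X) k (Fo A) (Fo B)"
    using m' unfolding socle_layer_arrow_def by blast
qed

lemma radical_diagrams:
  assumes F: "preserves_radical_filtrations C D Fo"
    and artC: "\<And>X. X \<in> Ob C \<Longrightarrow> source.artinian X"
  shows "preserves_radical_diagrams C D Fo"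
  unfolding preserves_radical_diagrams_def
proof (intro ballI allI impI)
  fix X k A B assume X: "X \<in> Ob C" and arrow: "radical_diagram_arrow C X k A B"
  obtain n m where m: "radical_filtration C X n m" and la: "layer_arrow C n (\<lambda>i. m (n - i)) k A B"
    using arrow unfolding radical_diagram_arrow_def radical_layer_arrow_def by blast
  have len: "loewy_length D (Fo X) n" if "X \<in> Ob C" "loewy_length C X n" for X n
    using F that unfolding preserves_radical_filtrations_def by blast
  note ss = F_semisimple[OF len]
  have lX: "loewy_length C X n" using m unfolding radical_filtration_def by blast
  obtain m' where m': "radical_filtration D (Fo X) n m'"
    and iso: "\<And>i. i \<in> {1..n} \<Longrightarrow> isomorphic D (Fo (Dom C (m i))) (Dom D (m' i))"
    using F X lX m unfolding preserves_radical_filtrations_def by blast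
  have art: "target.artinian (Fo X)"
    using len[OF X lX] target.semisimple_series_artinian unfolding loewy_length_def by blast
  have sub: "\<And>i. i \<le> n \<Longrightarrow> subobject C X (m i)" "\<And>i. i \<le> n \<Longrightarrow> subobject D (Fo X) (m' i)"
    using m m' unfolding radical_filtration_def by blast+
  \<comment> \<open>Here index 0 is the whole object, and each step yields first that the radical of
    the target lies below the image; the isomorphism upgrades this as before.\<close>
  have le: "sub_le D (m' i) (Fa (m i)) \<and> sub_le D (Fa (m i)) (m' i)" if "i \<le> n" for i
    using that
  proof (induction i)
    case 0
    have i: "iso_arr C (m 0)" "iso_arr D (m' 0)"
      using m m' unfolding radical_filtration_def by blast+
    note H = source.subobject_in_Hom[OF sub(1)[OF 0]] and FH = F_subobject(2)[OF sub(1)[OF 0]]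
      and H' = target.subobject_in_Hom[OF sub(2)[OF 0]]
    obtain g where g: "g \<in> Hom C X (Dom C (m 0))" "m 0 \<cdot>\<^bsub>C\<^esub> g = Id C X" by (rule source.iso_arrE[OF i(1) H])
    have "Fa (m 0) \<cdot>\<^bsub>D\<^esub> Fa g = Id D (Fo X)" using F_comp[OF g(1) H] g(2) F_id[OF X] by simp
    then have "Fa (m 0) \<cdot>\<^bsub>D\<^esub> (Fa g \<cdot>\<^bsub>D\<^esub> m' 0) = m' 0"
      using target.comp_assoc[OF H' F_hom[OF g(1)] FH] target.comp_id_left[OF H'] by simp
    then have 1: "sub_le D (m' 0) (Fa (m 0))"
      by (rule target.sub_leI[OF H' FH target.comp_in_Hom[OF H' F_hom[OF g(1)]]])
    obtain h where h: "h \<in> Hom D (Fo X) (Dom D (m' 0))" "m' 0 \<cdot>\<^bsub>D\<^esub> h = Id D (Fo X)"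
      by (rule target.iso_arrE[OF i(2) H'])
    have "m' 0 \<cdot>\<^bsub>D\<^esub> (h \<cdot>\<^bsub>D\<^esub> Fa (m 0)) = Fa (m 0)"
      using target.comp_assoc[OF FH h(1) H'] target.comp_id_left[OF FH] h(2) by simp
    then have "sub_le D (Fa (m 0)) (m' 0)"
      by (rule target.sub_leI[OF FH H' target.comp_in_Hom[OF FH h(1)]])
    then show ?case using 1 by blast
  next
    case (Suc i)
    obtain r r' where r: "is_radical C (Dom C (m i)) r" "m (Suc i) = m i \<cdot>\<^bsub>C\<^esub> r"
      "is_radical D (Dom D (m' i)) r'" "m' (Suc i) = m' i \<cdot>\<^bsub>D\<^esub> r'"
      using m m' Suc.prems unfolding radical_filtration_def by (meson Suc_le_lessD)
    have "Dom C (m i) \<in> Ob C"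
      using source.in_HomD(4)[OF source.subobject_in_Hom[OF sub(1)]] Suc.prems by simp
    then have *: "sub_le D (m' (Suc i)) (Fa (m (Suc i)))"
      using F_radical_step[OF ss sub(1) r(1) artC sub(2) r(3)] Suc r(2,4) by simp
    have "isomorphic D (Dom D (Fa (m (Suc i)))) (Dom D (m' (Suc i)))"
      using iso[of "Suc i"] F_Dom[OF sub(1)[OF Suc.prems]] Suc.prems by simp
    then show ?case
      using * target.artinian_isomorphic_sub_le[OF art sub(2)[OF Suc.prems] F_subobject(1)[OF sub(1)[OF Suc.prems]]]
      by blast
  qed
  \<comment> \<open>Radical filtrations are numbered from the top, layers from the bottom. Since
    both filtrations have the same length \<open>n\<close>, the same reversal applies on both
    sides.\<close>
  have "layer_arrow D n (\<lambda>i. m' (n - i)) k (Fo A) (Fo B)"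
    by (rule F_layer_arrow[OF la sub]) (use le in auto)
  then show "radical_layer_arrow D (Fo X) k (Fo A) (Fo B)"
    using m' unfolding radical_layer_arrow_def by blast
qed

end

theorem theorem1p2:
  fixes C :: "('o, 'm, 'z) precat_scheme" and K :: "('k, 'r) ring_scheme"
    and sc :: "'k \<Rightarrow> 'm \<Rightarrow> 'm"
    and D :: "('p, 'n, 'y) precat_scheme"
    and Fo :: "'o \<Rightarrow> 'p" and Fa :: "'m \<Rightarrow> 'n"
  assumes "locally_finite_category C K sc"
    and "abelian_category D"
    and "strong_exact_functor C D Fo Fa"
  shows "(preserves_socle_filtrations C D Fo \<longrightarrow> preserves_socle_diagrams C D Fo) \<and>
         (preserves_radical_filtrations C D Fo \<longrightarrow> preserves_radical_diagrams C D Fo)"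
proof -
  interpret source: locally_finite_category C K sc by (rule assms(1))
  interpret target: abelian_category D by (rule assms(2))
  interpret strong_exact_functor C D Fo Fa by (rule assms(3))
  interpret strong_exact_abelian_functor C D Fo Fa ..
  show ?thesis
    using socle_diagrams radical_diagrams source.finite_length_artinian[OF source.objects_finite_length] by blast
qed

end
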